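(* Assume: (a) the marginal CDF $F$ of the nonconformity scores $V_t$ is continuous and $\Theta=\sum_{k\ge0}\theta_k<\infty$; (b) there are $e>0$ and $0<c_f\le C_f<\infty$ such that $F$ has a density $f$ with $c_f\le f(v)\le C_f$ for $|v-q|\le e$, and this density is continuous at $q$; and $\mathbb P(V_s=V_t)=0$ for all distinct integer times $s,t$. Then, as $n\to\infty$, $$F(\widehat q_n)-(1-\alpha)=-\frac1n\sum_{t=1}^n\{\mathbf 1(V_t\le q)-(1-\alpha)\}+o_{\mathbb P}(n^{-1/2}),$$ $$\widehat q_n-q=-\frac1{n f(q)}\sum_{t=1}^n\{\mathbf 1(V_t\le q)-(1-\alpha)\}+o_{\mathbb P}(n^{-1/2}).$$
   Context: Setup. $(\varepsilon_t)_{t\in\mathbb Z}$ are iid random innovations (possibly vector-valued). $Z_t=(X_t,Y_t)$, with $X_t\in\mathbb R^d$, $Y_t\in\mathbb R$, is a stationary process of the form $Z_t=G(\ldots,\varepsilon_{t-1},\varepsilon_t)$ with a measurable function $G$. The predictor $\widehat\mu:\mathbb R^d\to\mathbb R$ is a fixed (nonrandom) measurable function. The nonconformity scores are $V_t=|Y_t-\widehat\mu(X_t)|=H(\ldots,\varepsilon_{t-1},\varepsilon_t)$, with a measurable function $H$. $F(v)=\mathbb P(V_t\le v)$. Split conformal cutoff. For fixed $0<\alpha<1$, $k_n=\lceil(n+1)(1-\alpha)\rceil$, and $\widehat q_n=V_{(k_n)}$ is the $k_n$-th order statistic of $V_1,\ldots,V_n$ (with $\widehat q_n=\infty$ if $k_n>n$).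 $q=F^{-1}(1-\alpha)=\inf\{v:F(v)\ge1-\alpha\}$. Functional dependence of threshold indicators. Let $\varepsilon_0'$ be an independent copy of $\varepsilon_0$, independent of all the innovations, and let $V_k^*$ be $V_k$ with $\varepsilon_0$ replaced by $\varepsilon_0'$, all other innovations unchanged. With $\|U\|_2=(\mathbb E|U|^2)^{1/2}$, $\theta_k=\sup_{v\in\mathbb R}\|\mathbf 1\{V_k\le v\}-\mathbf 1\{V_k^*\le v\}\|_2$ for $k\ge0$, and $\Theta=\sum_{k=0}^\infty\theta_k$. *)

theory Defs
  imports "HOL-Probability.Probability"
begin

text \<open>The shift \<open>(\<epsilon>\<^sub>t, \<epsilon>\<^sub>t\<^sub>-\<^sub>1, \<dots>)\<close>: coordinate \<open>j\<close> is the innovation \<open>j\<close> steps before time \<open>t\<close>.\<close>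

definition past :: "(int \<Rightarrow> 'w \<Rightarrow> 'e) \<Rightarrow> int \<Rightarrow> 'w \<Rightarrow> nat \<Rightarrow> 'e" where
  "past eps t \<omega> = (\<lambda>j. eps (t - int j) \<omega>)"

definition iid :: "'w measure \<Rightarrow> 'e measure \<Rightarrow> (int \<Rightarrow> 'w \<Rightarrow> 'e) \<Rightarrow> bool" where
  "iid M S eps \<longleftrightarrow>
     prob_space.indep_vars M (\<lambda>_. S) eps UNIV \<and> (\<forall>t. distr M S (eps t) = distr M S (eps 0))"

text \<open>\<open>eps'\<close> is distributed as \<open>eps 0\<close> and is independent of the whole family \<open>eps\<close>.\<close>

definition indep_copy ::
    "'w measure \<Rightarrow> 'e measure \<Rightarrow> (int \<Rightarrow> 'w \<Rightarrow> 'e) \<Rightarrow> ('w \<Rightarrow> 'e) \<Rightarrow> bool" where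
  "indep_copy M S eps eps' \<longleftrightarrow>
     eps' \<in> measurable M S \<and> distr M S eps' = distr M S (eps 0) \<and>
     prob_space.indep_set M
       (sets (vimage_algebra (space M) eps' S))
       (sets (vimage_algebra (space M) (\<lambda>\<omega> t. eps t \<omega>) (PiM UNIV (\<lambda>_. S))))"

text \<open>The function \<open>H\<close> with \<open>V\<^sub>t = H(\<dots>, \<epsilon>\<^sub>t\<^sub>-\<^sub>1, \<epsilon>\<^sub>t)\<close> when \<open>(X\<^sub>t, Y\<^sub>t) = G(\<dots>, \<epsilon>\<^sub>t\<^sub>-\<^sub>1, \<epsilon>\<^sub>t)\<close>.\<close>

definition score_fun :: "('p \<Rightarrow> 'x \<times> real) \<Rightarrow> ('x \<Rightarrow> real) \<Rightarrow> 'p \<Rightarrow> real" where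
  "score_fun G muhat h = \<bar>snd (G h) - muhat (fst (G h))\<bar>"

definition norm_L2 :: "'w measure \<Rightarrow> ('w \<Rightarrow> real) \<Rightarrow> real" where
  "norm_L2 M U = sqrt (\<integral>\<omega>. \<bar>U \<omega>\<bar>\<^sup>2 \<partial>M)"

text \<open>The supremum is over a family bounded by 1 when \<open>M\<close> is a probability space, so the
  real-valued supremum is the genuine one.\<close>

definition theta ::
    "'w measure \<Rightarrow> (int \<Rightarrow> 'w \<Rightarrow> real) \<Rightarrow> (int \<Rightarrow> 'w \<Rightarrow> real) \<Rightarrow> nat \<Rightarrow> real" where
  "theta M V V_star k =
     (SUP v. norm_L2 M (\<lambda>\<omega>. indicator {..v} (V (int k) \<omega>) - indicator {..v} (V_star (int k) \<omega>)))"

definition quantile :: "(real \<Rightarrow> real) \<Rightarrow> real \<Rightarrow> real" where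
  "quantile F p = Inf {v. F v \<ge> p}"

text \<open>The distribution function at an extended real, so that its value at \<open>\<infinity>\<close> is the total mass.\<close>

definition cdf_ereal :: "real measure \<Rightarrow> ereal \<Rightarrow> real" where
  "cdf_ereal \<mu> v = measure \<mu> {x. ereal x \<le> v}"

lemma cdf_ereal_ereal [simp]: "cdf_ereal \<mu> (ereal v) = cdf \<mu> v"
  by (simp add: cdf_ereal_def cdf_def atMost_def)

lemma cdf_ereal_infinity [simp]: "cdf_ereal \<mu> \<infinity> = measure \<mu> UNIV"
  by (simp add: cdf_ereal_def)

text \<open>\<open>f\<close> is a density of \<open>F\<close> on \<open>[l, u]\<close>; nothing is required outside this interval.\<close>

definition cdf_density_on :: "(real \<Rightarrow> real) \<Rightarrow> (real \<Rightarrow> real) \<Rightarrow> real \<Rightarrow> real \<Rightarrow> bool" where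
  "cdf_density_on F f l u \<longleftrightarrow>
     set_integrable lborel {l..u} f \<and>
     (\<forall>a b. l \<le> a \<longrightarrow> a \<le> b \<longrightarrow> b \<le> u \<longrightarrow> F b - F a = (LINT v:{a..b}|lborel. f v))"

text \<open>Order statistics are numbered from 1.\<close>

definition order_stat :: "nat \<Rightarrow> real list \<Rightarrow> real" where
  "order_stat k xs = sort xs ! (k - 1)"

definition conf_rank :: "real \<Rightarrow> nat \<Rightarrow> nat" where
  "conf_rank \<alpha> n = nat \<lceil>(real n + 1) * (1 - \<alpha>)\<rceil>"

definition conf_cutoff :: "(int \<Rightarrow> 'w \<Rightarrow> real) \<Rightarrow> real \<Rightarrow> nat \<Rightarrow> 'w \<Rightarrow> ereal" where
  "conf_cutoff V \<alpha> n \<omega> =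
     (if conf_rank \<alpha> n > n then \<infinity>
      else ereal (order_stat (conf_rank \<alpha> n) (map (\<lambda>t. V (int t) \<omega>) [1..<Suc n])))"

text \<open>\<open>R\<^sub>n = o\<^sub>P(a\<^sub>n)\<close>. The \<open>R\<^sub>n\<close> are extended-real-valued because the cutoff may be infinite.\<close>

definition small_oP :: "'w measure \<Rightarrow> (nat \<Rightarrow> 'w \<Rightarrow> ereal) \<Rightarrow> (nat \<Rightarrow> real) \<Rightarrow> bool" where
  "small_oP M R a \<longleftrightarrow>
     (\<forall>n. R n \<in> borel_measurable M) \<and>
     (\<forall>\<delta>>0. (\<lambda>n. measure M {\<omega> \<in> space M. \<bar>R n \<omega>\<bar> > ereal (\<delta> * a n)}) \<longlonglongrightarrow> 0)"

end

theory Submission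
  imports Defs "HOL-Real_Asymp.Real_Asymp"
begin

text \<open>The cutoff is a sample quantile, so the claim is a Bahadur representation under dependence. In rescaled
  form, it says that \<open>A = sqrt n (q_n - q)\<close> is close to \<open>B = - G_n(q) / f(q)\<close>, where \<open>G_n\<close> is the
  empirical process \<open>G_n(v) = n\<^sup>-\<^sup>1\<^sup>/\<^sup>2 \<Sum> (1{V_t \<le> v} - F v)\<close>. An order statistic is at most \<open>v\<close> iff enough
  observations are, hence \<open>A \<le> y\<close> is the event that \<open>- G_n(q + y n\<^sup>-\<^sup>1\<^sup>/\<^sup>2) / f(q)\<close> is at most a number
  tending to \<open>y\<close>. Ghosh's lemma (\<open>ghosh_comparison\<close>) then reduces \<open>A - B \<rightarrow> 0\<close> to two facts at fixed points:
  \<open>G_n(q)\<close> is bounded in probability, and \<open>G_n(q + y n\<^sup>-\<^sup>1\<^sup>/\<^sup>2) - G_n(q) \<rightarrow> 0\<close> for each \<open>y\<close>. Fixed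
  \<open>y\<close> suffice because, up to a small error, \<open>A\<close> and \<open>B\<close> only have to be compared with finitely many levels.

  Both facts are variance bounds. For a bounded function \<open>g\<close> of the past innovations whose value at time \<open>k\<close> changes by
  at most \<open>d k\<close> in \<open>L\<^sup>2\<close> when the innovation at time 0 is replaced, the variance of the partial sum is at most
  \<open>n (\<Sum>d)\<^sup>2 / 2\<close> (\<open>variance_sum_past_le\<close>). The usual proof projects on the filtration of the innovations; here the bound comes
  from the Efron-Stein inequality for infinitely many independent inputs (\<open>efron_stein\<close>), which follows by resampling
  one input after the other and exchanging each input with its copy, without conditional expectations. For the indicator
  of a threshold, \<open>d = \<theta>\<close> and the bound is \<open>n \<Theta>\<^sup>2 / 2\<close>. For the indicator of an interval of probability \<open>\<pi>\<close>, \<open>d k\<close> is at most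
  \<open>2 \<theta>\<^sub>k\<close> and at most \<open>2 sqrt \<pi>\<close>; as \<open>\<pi> \<rightarrow> 0\<close>, dominated convergence makes the sum of the minima vanish.

  A density continuous at \<open>q\<close> makes \<open>F\<close> differentiable there with derivative \<open>f(q) > 0\<close>. This turns shifts of
  \<open>q\<close> into levels of \<open>G_n\<close>, and it gives the expansion of \<open>F(q_n)\<close> from the one of \<open>q_n\<close> (\<open>linearize_in_prob\<close>).\<close>

section \<open>Independent inputs and their relabellings\<close>

lemma (in prob_space) integrable_bounded:
  fixes f :: "'a \<Rightarrow> real"
  assumes "f \<in> borel_measurable M" "\<And>x. x \<in> space M \<Longrightarrow> \<bar>f x\<bar> \<le> K"
  shows "integrable M f"
  by (rule integrable_const_bound[of _ K]) (use assms in \<open>auto intro!: AE_I2\<close>)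

text \<open>All invariances used below are of one kind: reading an independent and identically distributed
  family through an injective relabelling of its indices gives again such a family.\<close>

locale input_law = prob_space D for D :: "'e measure"
begin

abbreviation inputs :: "('i \<Rightarrow> 'e) measure" where
  "inputs \<equiv> PiM UNIV (\<lambda>_. D)"

lemma prob_space_inputs: "prob_space (inputs :: ('i \<Rightarrow> 'e) measure)"
  by (intro prob_space_PiM prob_space_axioms)

lemma measurable_relabel:
  "(\<lambda>z i. z (\<phi> i)) \<in> measurable inputs inputs"
  by (intro measurable_PiM_single') (auto simp: space_PiM)

lemma distr_relabel:
  fixes \<phi> :: "'i \<Rightarrow> 'j"
  assumes "inj \<phi>"
  shows "distr inputs inputs (\<lambda>z i. z (\<phi> i)) = inputs"
  using distr_PiM_reindex[of UNIV "\<lambda>_. D" \<phi> UNIV] assms prob_space_axioms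
  by (simp add: restrict_UNIV)

lemma integral_relabel:
  fixes f :: "('i \<Rightarrow> 'e) \<Rightarrow> real" and \<phi> :: "'i \<Rightarrow> 'j"
  assumes "inj \<phi>" and [measurable]: "f \<in> borel_measurable inputs"
  shows "(\<integral>z. f (\<lambda>i. z (\<phi> i)) \<partial>inputs) = (\<integral>x. f x \<partial>inputs)"
proof -
  have "(\<integral>x. f x \<partial>inputs) = (\<integral>x. f x \<partial>distr inputs inputs (\<lambda>z i. z (\<phi> i)))"
    by (simp only: distr_relabel[OF assms(1)])
  also have "\<dots> = (\<integral>z. f (\<lambda>i. z (\<phi> i)) \<partial>inputs)"
    by (rule integral_distr) (simp_all add: measurable_relabel)
  finally show ?thesis by simp
qed

lemma indep_relabel:
  fixes \<phi> \<psi> :: "'i \<Rightarrow> 'k"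
  assumes "range \<phi> \<inter> range \<psi> = {}"
  shows "prob_space.indep_var inputs inputs (\<lambda>z i. z (\<phi> i)) inputs (\<lambda>z i. z (\<psi> i))"
proof -
  interpret I: prob_space "inputs :: ('k \<Rightarrow> 'e) measure" by (rule prob_space_inputs)
  have "I.indep_vars (\<lambda>_. D) (\<lambda>k z. z k) UNIV"
    by (subst I.indep_vars_iff_distr_eq_PiM)
       (simp_all add: distr_PiM_component[OF prob_space_axioms] restrict_UNIV distr_id2)
  from I.indep_var_restrict[OF this assms]
  have ind: "I.indep_var (PiM (range \<phi>) (\<lambda>_. D)) (\<lambda>z. restrict z (range \<phi>))
                   (PiM (range \<psi>) (\<lambda>_. D)) (\<lambda>z. restrict z (range \<psi>))"
    by simp
  have m1: "(\<lambda>z i. z (\<phi> i)) \<in> measurable (PiM (range \<phi>) (\<lambda>_. D)) inputs"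
    by (intro measurable_PiM_single') (auto simp: space_PiM PiE_iff)
  have m2: "(\<lambda>z i. z (\<psi> i)) \<in> measurable (PiM (range \<psi>) (\<lambda>_. D)) inputs"
    by (intro measurable_PiM_single') (auto simp: space_PiM PiE_iff)
  from I.indep_var_compose[OF ind m1 m2] show ?thesis
    by (simp add: comp_def)
qed

text \<open>An array indexed by \<open>nat \<times> bool\<close> carries two independent input sequences at once: the original one
  (flag \<open>False\<close>) and an independent copy (flag \<open>True\<close>). Then \<open>mix J\<close> is the original sequence with the
  inputs in \<open>J\<close> resampled, and every resampling used in the proofs lives on this one space.\<close>

definition mix :: "nat set \<Rightarrow> (nat \<times> bool \<Rightarrow> 'e) \<Rightarrow> nat \<Rightarrow> 'e" where
  "mix J z = (\<lambda>i. z (i, i \<in> J))"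

lemma measurable_mix [measurable]: "mix J \<in> measurable inputs inputs"
  unfolding mix_def by (rule measurable_relabel)

lemma distr_mix: "distr inputs inputs (mix J) = inputs"
  using distr_relabel[of "\<lambda>i. (i, i \<in> J)"] by (simp add: mix_def[abs_def] inj_on_def)

lemma integral_mix:
  fixes f :: "(nat \<Rightarrow> 'e) \<Rightarrow> real"
  assumes "f \<in> borel_measurable inputs"
  shows "(\<integral>z. f (mix J z) \<partial>inputs) = (\<integral>x. f x \<partial>inputs)"
  unfolding mix_def using assms by (intro integral_relabel) (auto simp: inj_on_def)

text \<open>Exchanging original and copy at the indices in \<open>J\<close> is an injective relabelling of the array, and
  it turns \<open>mix K\<close> into \<open>mix (sym_diff K J)\<close>.\<close>

lemma integral_mix_swap:
  fixes \<Phi> :: "(nat \<Rightarrow> 'e) \<Rightarrow> (nat \<Rightarrow> 'e) \<Rightarrow> (nat \<Rightarrow> 'e) \<Rightarrow> real"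
  assumes [measurable]: "(\<lambda>z. \<Phi> (mix K1 z) (mix K2 z) (mix K3 z)) \<in> borel_measurable inputs"
  shows "(\<integral>z. \<Phi> (mix (sym_diff K1 J) z) (mix (sym_diff K2 J) z) (mix (sym_diff K3 J) z) \<partial>inputs)
       = (\<integral>z. \<Phi> (mix K1 z) (mix K2 z) (mix K3 z) \<partial>inputs)"
proof -
  define sw where "sw = (\<lambda>(i, b). (i, b \<noteq> (i \<in> J)))"
  have "inj sw" by (auto simp: sw_def inj_on_def)
  have mix_sw: "mix K (\<lambda>p. z (sw p)) = mix (sym_diff K J) z" for K z
    by (rule ext) (simp add: mix_def sw_def, rule arg_cong[of _ _ z], auto)
  show ?thesis
    using integral_relabel[OF \<open>inj sw\<close> assms] by (simp only: mix_sw)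
qed

lemma indep_mix: "prob_space.indep_var inputs inputs (mix {}) inputs (mix UNIV)"
proof -
  have "range (\<lambda>i::nat. (i, i \<in> {})) \<inter> range (\<lambda>i. (i, i \<in> (UNIV::nat set))) = {}" by auto
  from indep_relabel[OF this] show ?thesis by (simp add: mix_def[abs_def])
qed

text \<open>Resampling more and more inputs makes the sequence independent of the original one in the limit.
  This replaces conditioning on the remote past, and it is where the triviality of the tail enters:
  for a cylinder set the resampled sequence eventually agrees with the copy on all coordinates that
  matter, and the property passes to all sets by the \<open>\<pi>\<close>-\<open>\<lambda>\<close> theorem and to all integrable functions
  by approximation.\<close>

lemma mix_decouples:
  fixes a b :: "(nat \<Rightarrow> 'e) \<Rightarrow> real"
  assumes [measurable]: "a \<in> borel_measurable inputs"
    and a: "\<And>x. \<bar>a x\<bar> \<le> K" and b: "integrable inputs b"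
  shows "(\<lambda>m. \<integral>z. a (mix {} z) * b (mix {..<m} z) \<partial>inputs) \<longlonglongrightarrow> (\<integral>x. a x \<partial>inputs) * (\<integral>x. b x \<partial>inputs)"
proof -
  interpret N: prob_space "inputs :: (nat \<Rightarrow> 'e) measure" by (rule prob_space_inputs)
  interpret Q: prob_space "inputs :: (nat \<times> bool \<Rightarrow> 'e) measure" by (rule prob_space_inputs)
  have K: "K \<ge> 0" using a[of undefined] by linarith
  have mixint: "integrable inputs (\<lambda>z. b (mix J z))" if "integrable inputs b" for J and b :: "_ \<Rightarrow> real"
  proof -
    have [measurable]: "b \<in> borel_measurable inputs" using that by (rule borel_measurable_integrable)
    show ?thesis
      by (rule integrable_distr[OF measurable_mix]) (simp only: distr_mix that)
  qed
  have prodint: "integrable inputs (\<lambda>z. a (mix {} z) * b (mix J z))" if "integrable inputs b"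
    for J and b :: "_ \<Rightarrow> real"
  proof -
    have [measurable]: "b \<in> borel_measurable inputs" using that by (rule borel_measurable_integrable)
    have "integrable inputs (\<lambda>z. K * b (mix J z))" using mixint[OF that] by simp
    then show ?thesis
      by (rule Bochner_Integration.integrable_bound)
         (use K in \<open>auto simp: abs_mult intro!: mult_right_mono a\<close>)
  qed
  let ?L = "\<lambda>b::(nat \<Rightarrow> 'e) \<Rightarrow> real. (\<lambda>m. \<integral>z. a (mix {} z) * b (mix {..<m} z) \<partial>inputs) \<longlonglongrightarrow> (\<integral>x. a x \<partial>inputs) * (\<integral>x. b x \<partial>inputs)"
  have intind: "integrable inputs (indicator B :: (nat \<Rightarrow> 'e) \<Rightarrow> real)" if "B \<in> sets inputs" for B
    using that by (intro N.integrable_bounded[of _ 1]) (auto simp: indicator_def)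
  have plus: "?L (\<lambda>x. f x + g x)" if "integrable inputs f" "integrable inputs g" "?L f" "?L g"
    for f g :: "(nat \<Rightarrow> 'e) \<Rightarrow> real"
    using tendsto_add[OF that(3,4)] prodint[OF that(1)] prodint[OF that(2)] that(1,2)
    by (simp add: ring_distribs)
  \<comment> \<open>Closure under dominated limits: the error is at most \<open>K\<close> times an \<open>L\<^sup>1\<close> distance, whatever \<open>m\<close> is,
      so the limits in \<open>n\<close> and \<open>m\<close> may be exchanged.\<close>
  have close: "?L f" if s: "\<And>n. integrable inputs (s n)" "\<And>n. ?L (s n)" and f: "integrable inputs f"
    and lim: "\<And>x. x \<in> space inputs \<Longrightarrow> (\<lambda>n. s n x) \<longlonglongrightarrow> f x"
    and bd: "\<And>n x. x \<in> space inputs \<Longrightarrow> \<bar>s n x\<bar> \<le> 2 * \<bar>f x\<bar>"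
    for f :: "(nat \<Rightarrow> 'e) \<Rightarrow> real" and s
  proof -
    have [measurable]: "f \<in> borel_measurable inputs" "s n \<in> borel_measurable inputs" for n
      using f s by (auto intro: borel_measurable_integrable)
    have "(\<lambda>n. \<integral>x. s n x \<partial>inputs) \<longlonglongrightarrow> (\<integral>x. f x \<partial>inputs)"
      by (rule integral_dominated_convergence[where w="\<lambda>x. 2 * \<bar>f x\<bar>"])
         (use f lim bd in auto)
    then have g: "(\<lambda>n. (\<integral>x. a x \<partial>inputs) * (\<integral>x. s n x \<partial>inputs)) \<longlonglongrightarrow> (\<integral>x. a x \<partial>inputs) * (\<integral>x. f x \<partial>inputs)"
      by (rule tendsto_mult_left)
    have "(\<lambda>n. \<integral>x. \<bar>s n x - f x\<bar> \<partial>inputs) \<longlonglongrightarrow> (\<integral>x. 0 \<partial>(inputs :: (nat \<Rightarrow> 'e) measure))"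
    proof (rule integral_dominated_convergence[where w="\<lambda>x. 3 * \<bar>f x\<bar>"])
      show "AE x in inputs. (\<lambda>n. \<bar>s n x - f x\<bar>) \<longlonglongrightarrow> 0"
        using lim by (auto intro!: AE_I2 tendsto_rabs_zero simp: LIM_zero)
      show "AE x in inputs. norm \<bar>s n x - f x\<bar> \<le> 3 * \<bar>f x\<bar>" for n
        using bd[of _ n] by (auto intro!: AE_I2 order.trans[OF abs_triangle_ineq4] simp: numeral_eq_Suc)
    qed (use f in auto)
    then have d: "(\<lambda>n. K * (\<integral>x. \<bar>s n x - f x\<bar> \<partial>inputs)) \<longlonglongrightarrow> 0"
      using tendsto_mult_left[of _ 0 sequentially K] by simp
    have le: "\<bar>(\<integral>z. a (mix {} z) * s n (mix {..<m} z) \<partial>inputs) - (\<integral>z. a (mix {} z) * f (mix {..<m} z) \<partial>inputs)\<bar>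
        \<le> K * (\<integral>x. \<bar>s n x - f x\<bar> \<partial>inputs)" for n m
    proof -
      have "(\<integral>z. a (mix {} z) * s n (mix {..<m} z) \<partial>inputs) - (\<integral>z. a (mix {} z) * f (mix {..<m} z) \<partial>inputs)
        = (\<integral>z. a (mix {} z) * (s n (mix {..<m} z) - f (mix {..<m} z)) \<partial>inputs)"
        using prodint[OF s(1), of n] prodint[OF f] by (simp add: right_diff_distrib)
      also have "\<bar>\<dots>\<bar> \<le> (\<integral>z. \<bar>a (mix {} z) * (s n (mix {..<m} z) - f (mix {..<m} z))\<bar> \<partial>inputs)"
        by (rule integral_abs_bound)
      also have "\<dots> \<le> (\<integral>z. K * \<bar>s n (mix {..<m} z) - f (mix {..<m} z)\<bar> \<partial>inputs)"
      proof (rule integral_mono)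
        show "integrable inputs (\<lambda>z. \<bar>a (mix {} z) * (s n (mix {..<m} z) - f (mix {..<m} z))\<bar>)"
          using s(1)[of n] f by (intro integrable_abs prodint[of "\<lambda>x. s n x - f x"]) auto
        show "integrable inputs (\<lambda>z. K * \<bar>s n (mix {..<m} z) - f (mix {..<m} z)\<bar>)"
          using s(1)[of n] f mixint[of "\<lambda>x. \<bar>s n x - f x\<bar>" "{..<m}"] by auto
      qed (auto simp: abs_mult intro!: mult_right_mono a)
      also have "\<dots> = K * (\<integral>x. \<bar>s n x - f x\<bar> \<partial>inputs)"
        using integral_mix[of "\<lambda>x. \<bar>s n x - f x\<bar>" "{..<m}"] by simp
      finally show ?thesis .
    qed
    have "uniform_limit UNIV (\<lambda>n m. \<integral>z. a (mix {} z) * s n (mix {..<m} z) \<partial>inputs)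
       (\<lambda>m. \<integral>z. a (mix {} z) * f (mix {..<m} z) \<partial>inputs) sequentially"
    proof (rule uniform_limitI)
      fix r :: real assume "r > 0"
      from order_tendstoD(2)[OF d this]
      show "\<forall>\<^sub>F n in sequentially. \<forall>m\<in>UNIV. dist (\<integral>z. a (mix {} z) * s n (mix {..<m} z) \<partial>inputs)
          (\<integral>z. a (mix {} z) * f (mix {..<m} z) \<partial>inputs) < r"
        by eventually_elim (use le in \<open>auto simp: dist_real_def intro: le_less_trans\<close>)
    qed
    from swap_uniform_limit'[OF _ g this] show ?thesis using s(2) by simp
  qed
  have ind: "?L (indicator B)" if "B \<in> sets inputs" for B
    using Int_stable_prod_algebra[of UNIV "\<lambda>_. D"] prod_algebra_sets_into_space[of UNIV "\<lambda>_. D"]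
      that[unfolded sets_PiM]
  proof (induction B rule: sigma_sets_induct_disjoint)
    case (basic B)
    have [measurable]: "B \<in> sets inputs"
      unfolding sets_PiM using basic by auto
    from basic obtain J E where B: "B = prod_emb UNIV (\<lambda>_. D) J (\<Pi>\<^sub>E j\<in>J. E j)" "finite J"
      "\<And>i. i \<in> J \<Longrightarrow> E i \<in> sets D"
      by (rule prod_algebraE) auto
    then obtain m0 where m0: "J \<subseteq> {..<m0}"
      using finite_nat_bounded by blast
    have ev: "(\<integral>z. a (mix {} z) * indicator B (mix {..<m} z) \<partial>inputs) = (\<integral>x. a x \<partial>inputs) * (\<integral>x. indicator B x \<partial>inputs)"
      if "m \<ge> m0" for m
    proof -
      \<comment> \<open>Once \<open>m\<close> exceeds all coordinates in \<open>J\<close>, the cylinder set no longer sees any original input.\<close>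
      have eq: "(indicator B (mix {..<m} z) :: real) = indicator B (mix UNIV z)" if z: "z \<in> space inputs" for z
      proof -
        have "mix {..<m} z i = mix UNIV z i" if "i \<in> J" for i
          using that m0 \<open>m \<ge> m0\<close> by (auto simp: mix_def)
        then show ?thesis using z
          unfolding B(1) prod_emb_def
          by (auto simp: indicator_def PiE_iff space_PiM mix_def)
      qed
      have ind: "Q.indep_var borel (\<lambda>z. a (mix {} z)) borel (\<lambda>z. indicator B (mix UNIV z) :: real)"
        using Q.indep_var_compose[OF indep_mix, of a borel "indicator B" borel]
        by (simp add: comp_def)
      have "(\<integral>z. a (mix {} z) * indicator B (mix {..<m} z) \<partial>inputs)
          = (\<integral>z. a (mix {} z) * indicator B (mix UNIV z) \<partial>inputs)"
        by (intro Bochner_Integration.integral_cong) (simp_all add: eq)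
      also have "\<dots> = (\<integral>z. a (mix {} z) \<partial>inputs) * (\<integral>z. indicator B (mix UNIV z) \<partial>inputs)"
        by (intro Q.indep_var_lebesgue_integral ind Q.integrable_bounded[of _ K] Q.integrable_bounded[of _ 1])
           (auto simp: a indicator_def)
      also have "\<dots> = (\<integral>x. a x \<partial>inputs) * (\<integral>x. indicator B x \<partial>inputs)"
        by (simp add: integral_mix)
      finally show ?thesis .
    qed
    show ?case
      by (rule tendsto_eventually) (use ev in \<open>auto simp: eventually_sequentially\<close>)
  next
    case empty
    show ?case by simp
  next
    case (compl B)
    then have B: "B \<in> sets inputs" by (simp add: sets_PiM)
    have sp: "space (inputs :: (nat \<Rightarrow> 'e) measure) = (\<Pi>\<^sub>E i\<in>UNIV. space D)" by (simp add: space_PiM)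
    have i: "(\<integral>z. a (mix {} z) * indicator ((\<Pi>\<^sub>E i\<in>UNIV. space D) - B) (mix {..<m} z) \<partial>inputs)
       = (\<integral>z. a (mix {} z) \<partial>inputs) - (\<integral>z. a (mix {} z) * indicator B (mix {..<m} z) \<partial>inputs)" for m
    proof -
      have "(\<integral>z. a (mix {} z) * indicator ((\<Pi>\<^sub>E i\<in>UNIV. space D) - B) (mix {..<m} z) \<partial>inputs)
        = (\<integral>z. a (mix {} z) - a (mix {} z) * indicator B (mix {..<m} z) \<partial>inputs)"
        by (intro Bochner_Integration.integral_cong)
           (auto simp: indicator_def space_PiM mix_def PiE_iff)
      also have "\<dots> = (\<integral>z. a (mix {} z) \<partial>inputs) - (\<integral>z. a (mix {} z) * indicator B (mix {..<m} z) \<partial>inputs)"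
        by (intro Bochner_Integration.integral_diff Q.integrable_bounded[of _ K] prodint intind B)
           (auto simp: a)
      finally show ?thesis .
    qed
    have j: "(\<integral>x. indicator ((\<Pi>\<^sub>E i\<in>UNIV. space D) - B) x \<partial>inputs) = (1::real) - (\<integral>x. indicator B x \<partial>inputs)"
      using N.prob_compl[OF B] B sets.sets_into_space[OF B] by (simp add: sp Int_absorb2 Diff_subset)
    show ?case
      unfolding i j integral_mix[OF assms(1)] right_diff_distrib
      by (intro tendsto_diff) (use compl in auto)
  next
    case (union B)
    then have B [measurable]: "B i \<in> sets inputs" for i by (auto simp: sets_PiM)
    have fin: "?L (\<lambda>x. \<Sum>k<n. indicator (B k) x)" for n
    proof (induction n)
      case (Suc n)
      have "integrable inputs (\<lambda>x. \<Sum>k<n. indicator (B k) x :: real)"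
        by (intro Bochner_Integration.integrable_sum intind B)
      from plus[OF this intind[OF B] Suc union(3)[of n]] show ?case by simp
    qed simp
    show ?case
    proof (rule close[OF _ fin])
      have *: "(\<lambda>k. indicator (B k) x) sums (indicator (\<Union>(range B)) x :: real)" for x
        using indicator_sums[of B x] union(1) by (auto simp: disjoint_family_on_def)
      show "(\<lambda>n. \<Sum>k<n. indicator (B k) x) \<longlonglongrightarrow> (indicator (\<Union>(range B)) x :: real)" for x
        using * by (simp add: sums_def)
      show "\<bar>\<Sum>k<n. indicator (B k) x :: real\<bar> \<le> 2 * \<bar>indicator (\<Union>(range B)) x\<bar>" for n x
      proof -
        have "(\<Sum>k<n. indicator (B k) x :: real) \<le> indicator (\<Union>(range B)) x"
          using sum_le_suminf[OF sums_summable[OF *], of "{..<n}" x] sums_unique[OF *[of x]] by auto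
        moreover have "0 \<le> (\<Sum>k<n. indicator (B k) x :: real)" by (intro sum_nonneg) auto
        ultimately show ?thesis by simp
      qed
    qed (use B in \<open>auto intro!: Bochner_Integration.integrable_sum intind\<close>)
  qed
  from b show ?thesis
  proof (induction rule: integrable_induct)
    case (base A c)
    show ?case using tendsto_mult_left[OF ind[OF base(1)], of c] by (simp add: ac_simps)
  next
    case (add f g)
    then show ?case by (intro plus)
  next
    case (lim f s)
    show ?case by (rule close[of s]) (use lim in auto)
  qed
qed

end

section \<open>The Efron-Stein inequality\<close>

text \<open>The Cauchy-Schwarz inequality with bounds in place of norms; the bounds may vanish, so the weighted
  inequality of arithmetic and geometric means is applied to \<open>c + h\<close> and \<open>d + h\<close> with \<open>h\<close> decreasing to 0.\<close>

lemma integral_mult_le_L2: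
  fixes a b :: "'a \<Rightarrow> real"
  assumes ia: "integrable M (\<lambda>x. (a x)\<^sup>2)" and ib: "integrable M (\<lambda>x. (b x)\<^sup>2)"
    and iab: "integrable M (\<lambda>x. a x * b x)"
    and a: "(\<integral>x. (a x)\<^sup>2 \<partial>M) \<le> c\<^sup>2" and b: "(\<integral>x. (b x)\<^sup>2 \<partial>M) \<le> d\<^sup>2"
    and "0 \<le> c" "0 \<le> d"
  shows "(\<integral>x. a x * b x \<partial>M) \<le> c * d"
proof -
  have le: "(\<integral>x. a x * b x \<partial>M) \<le> (c + h) * (d + h)" if h: "h > 0" for h
  proof -
    define c' d' where "c' = c + h" and "d' = d + h"
    have pos: "c' > 0" "d' > 0" using h assms by (simp_all add: c'_def d'_def)
    have "a x * b x \<le> (d' / c') / 2 * (a x)\<^sup>2 + (c' / d') / 2 * (b x)\<^sup>2" for x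
    proof -
      have "0 \<le> (d' * a x - c' * b x)\<^sup>2" by simp
      then have "2 * (c' * d') * (a x * b x) \<le> d'\<^sup>2 * (a x)\<^sup>2 + c'\<^sup>2 * (b x)\<^sup>2"
        by (simp add: power2_diff power_mult_distrib algebra_simps)
      then have "a x * b x \<le> (d'\<^sup>2 * (a x)\<^sup>2 + c'\<^sup>2 * (b x)\<^sup>2) / (2 * (c' * d'))"
        using pos by (simp add: pos_le_divide_eq mult.commute)
      also have "\<dots> = (d' / c') / 2 * (a x)\<^sup>2 + (c' / d') / 2 * (b x)\<^sup>2"
        using pos by (simp add: field_simps power2_eq_square)
      finally show ?thesis .
    qed
    then have "(\<integral>x. a x * b x \<partial>M) \<le> (\<integral>x. (d' / c') / 2 * (a x)\<^sup>2 + (c' / d') / 2 * (b x)\<^sup>2 \<partial>M)"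
      using ia ib by (intro integral_mono iab) auto
    also have "\<dots> = (d' / c') / 2 * (\<integral>x. (a x)\<^sup>2 \<partial>M) + (c' / d') / 2 * (\<integral>x. (b x)\<^sup>2 \<partial>M)"
      using ia ib by simp
    also have "\<dots> \<le> (d' / c') / 2 * c'\<^sup>2 + (c' / d') / 2 * d'\<^sup>2"
    proof -
      have "c\<^sup>2 \<le> c'\<^sup>2" "d\<^sup>2 \<le> d'\<^sup>2"
        using h assms by (auto simp: c'_def d'_def intro!: power_mono)
      then show ?thesis using pos a b by (intro add_mono mult_left_mono) auto
    qed
    also have "\<dots> = c' * d'" using pos by (simp add: field_simps power2_eq_square)
    finally show ?thesis by (simp add: c'_def d'_def)
  qed
  have "((\<lambda>h. (c + h) * (d + h)) \<longlongrightarrow> (c + 0) * (d + 0)) (at_right 0)"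
    by (intro tendsto_intros)
  then have "(\<integral>x. a x * b x \<partial>M) \<le> (c + 0) * (d + 0)"
    by (rule tendsto_lowerbound) (auto simp: eventually_at_right_less le intro: eventually_mono[OF eventually_at_right_less])
  then show ?thesis by simp
qed

context input_law
begin

text \<open>The Efron-Stein inequality for functions of infinitely many inputs. Resample the inputs one after
  another and telescope \<open>E f(x) f(x) - E f(x) f(mix {..<m})\<close>, whose limit is the variance. In the \<open>i\<close>th
  term, exchanging the \<open>i\<close>th input with its copy changes the sign of the second factor and
  resamples the first one; averaging both forms gives a product of two resampling increments, and each
  of them has the law of \<open>f (mix {} z) - f (mix {i} z)\<close>.\<close>

theorem efron_stein:
  fixes f :: "(nat \<Rightarrow> 'e) \<Rightarrow> real"
  assumes [measurable]: "f \<in> borel_measurable inputs" and f: "\<And>x. \<bar>f x\<bar> \<le> K"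
    and B: "\<And>m. (\<Sum>i<m. \<integral>z. (f (mix {} z) - f (mix {i} z))\<^sup>2 \<partial>inputs) \<le> B"
  shows "(\<integral>x. (f x - (\<integral>x. f x \<partial>inputs))\<^sup>2 \<partial>inputs) \<le> B / 2"
proof -
  interpret N: prob_space "inputs :: (nat \<Rightarrow> 'e) measure" by (rule prob_space_inputs)
  interpret Q: prob_space "inputs :: (nat \<times> bool \<Rightarrow> 'e) measure" by (rule prob_space_inputs)
  have fb: "\<bar>f x * f y\<bar> \<le> K * K" for x y
    using f[of x] f[of y] unfolding abs_mult by (intro mult_mono) auto
  have int2: "integrable inputs (\<lambda>z. f (mix J z) * f (mix J' z))" for J J'
    by (rule Q.integrable_bounded[of _ "K * K"]) (use fb in auto)
  define infl where "infl i = (\<integral>z. (f (mix {} z) - f (mix {i} z))\<^sup>2 \<partial>inputs)" for i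
  define I where "I i = (\<integral>z. f (mix {} z) * (f (mix {..<i} z) - f (mix {..<Suc i} z)) \<partial>inputs)" for i
  have int: "integrable inputs (\<lambda>z. (f (mix J z) - f (mix J' z)) * (f (mix L z) - f (mix L' z)))" for J J' L L'
    using int2 by (simp add: algebra_simps)
  have step: "I i \<le> infl i / 2" for i
  proof -
    have sd: "sym_diff {..<i} {i} = {..<Suc i}" "sym_diff {..<Suc i} {i} = {..<i}" "sym_diff {i} {..<i} = {..<Suc i}"
      by auto
    have I': "(\<integral>z. f (mix {i} z) * (f (mix {..<Suc i} z) - f (mix {..<i} z)) \<partial>inputs) = I i"
      using integral_mix_swap[of "\<lambda>x u v. f x * (f u - f v)" "{}" "{..<i}" "{..<Suc i}" "{i}"]
      unfolding sd by (simp add: I_def)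
    have infl': "(\<integral>z. (f (mix {..<i} z) - f (mix {..<Suc i} z))\<^sup>2 \<partial>inputs) = infl i"
      using integral_mix_swap[of "\<lambda>x u v. (f u - f v)\<^sup>2" "{}" "{}" "{i}" "{..<i}"]
      unfolding sd by (simp add: infl_def)
    have "2 * I i = (\<integral>z. f (mix {} z) * (f (mix {..<i} z) - f (mix {..<Suc i} z)) \<partial>inputs)
        + (\<integral>z. f (mix {i} z) * (f (mix {..<Suc i} z) - f (mix {..<i} z)) \<partial>inputs)"
      unfolding I' by (simp add: I_def)
    also have "\<dots> = (\<integral>z. (f (mix {} z) - f (mix {i} z)) * (f (mix {..<i} z) - f (mix {..<Suc i} z)) \<partial>inputs)"
      using int2 by (simp add: algebra_simps)
    also have "\<dots> \<le> (\<integral>z. ((f (mix {} z) - f (mix {i} z))\<^sup>2 + (f (mix {..<i} z) - f (mix {..<Suc i} z))\<^sup>2) / 2 \<partial>inputs)"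
    proof (intro integral_mono int)
      show "integrable inputs (\<lambda>z. ((f (mix {} z) - f (mix {i} z))\<^sup>2 + (f (mix {..<i} z) - f (mix {..<Suc i} z))\<^sup>2) / 2)"
        unfolding power2_eq_square by (intro integrable_divide Bochner_Integration.integrable_add int)
      show "u * v \<le> (u\<^sup>2 + v\<^sup>2) / 2" for u v :: real
        using sum_squares_bound[of u v] by simp
    qed
    also have "\<dots> = infl i"
      using infl' int by (simp add: infl_def power2_eq_square)
    finally show ?thesis by simp
  qed
  \<comment> \<open>\<open>mix {..<0}\<close> is the original sequence, so the telescoping sum starts at the second moment.\<close>
  have tele: "(\<integral>z. f (mix {} z) * f (mix {} z) \<partial>inputs) - (\<integral>z. f (mix {} z) * f (mix {..<m} z) \<partial>inputs) = (\<Sum>i<m. I i)" for m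
  proof (induction m)
    case (Suc m)
    have "I m = (\<integral>z. f (mix {} z) * f (mix {..<m} z) \<partial>inputs) - (\<integral>z. f (mix {} z) * f (mix {..<Suc m} z) \<partial>inputs)"
      unfolding I_def right_diff_distrib using int2 by (intro Bochner_Integration.integral_diff)
    then show ?case using Suc by simp
  qed simp
  have "(\<Sum>i<m. I i) \<le> B / 2" for m
    using sum_mono[of "{..<m}" I "\<lambda>i. infl i / 2"] step B[of m]
    by (simp add: infl_def flip: sum_divide_distrib)
  then have le: "(\<integral>z. f (mix {} z) * f (mix {} z) \<partial>inputs) - (\<integral>z. f (mix {} z) * f (mix {..<m} z) \<partial>inputs) \<le> B / 2" for m
    by (simp add: tele)
  have "(\<lambda>m. (\<integral>z. f (mix {} z) * f (mix {} z) \<partial>inputs) - (\<integral>z. f (mix {} z) * f (mix {..<m} z) \<partial>inputs))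
     \<longlonglongrightarrow> (\<integral>z. f (mix {} z) * f (mix {} z) \<partial>inputs) - (\<integral>x. f x \<partial>inputs) * (\<integral>x. f x \<partial>inputs)"
    by (intro tendsto_diff tendsto_const mix_decouples[of _ K] f N.integrable_bounded[of _ K]) (use f in auto)
  then have "(\<integral>z. f (mix {} z) * f (mix {} z) \<partial>inputs) - (\<integral>x. f x \<partial>inputs) * (\<integral>x. f x \<partial>inputs) \<le> B / 2"
    by (rule LIMSEQ_le_const2) (use le in auto)
  moreover have "(\<integral>z. f (mix {} z) * f (mix {} z) \<partial>inputs) = (\<integral>x. f x * f x \<partial>inputs)"
    using integral_mix[of "\<lambda>x. f x * f x"] by simp
  moreover have "N.variance f = N.expectation (\<lambda>x. (f x)\<^sup>2) - (N.expectation f)\<^sup>2"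
    using N.integrable_bounded[of f K] N.integrable_bounded[of "\<lambda>x. (f x)\<^sup>2" "K * K"] f abs_le_D1[OF fb]
    by (intro N.variance_eq) (auto simp: power2_eq_square)
  ultimately show ?thesis by (simp add: power2_eq_square)
qed

section \<open>Partial sums of a stationary causal process\<close>

text \<open>A partial sum over \<open>n\<close> times is a function of one input sequence, read backwards from the last time.
  Resampling its \<open>i\<close>th input moves the summand at lag \<open>s\<close> by at most \<open>d (i - s)\<close> in \<open>L\<^sup>2\<close>, and not at all
  if \<open>i < s\<close>. Hence the squared influences add up to at most \<open>n (\<Sum>d)\<^sup>2\<close>, a Toeplitz (Young) bound, and
  the Efron-Stein inequality applies.\<close>

lemma variance_shift_sum_le:
  fixes g :: "(nat \<Rightarrow> 'e) \<Rightarrow> real" and d :: "nat \<Rightarrow> real"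
  assumes g_meas [measurable]: "g \<in> borel_measurable inputs" and g: "\<And>x. \<bar>g x\<bar> \<le> K"
    and d: "\<And>k. 0 \<le> d k" "summable d"
    and infl: "\<And>k. (\<integral>z. (g (mix {} z) - g (mix {k} z))\<^sup>2 \<partial>inputs) \<le> (d k)\<^sup>2"
  shows "(\<integral>x. (\<Sum>s<n. g (\<lambda>j. x (s + j)) - (\<integral>x. g x \<partial>inputs))\<^sup>2 \<partial>inputs) \<le> real n * (suminf d)\<^sup>2 / 2"
proof -
  interpret N: prob_space "inputs :: (nat \<Rightarrow> 'e) measure" by (rule prob_space_inputs)
  interpret Q: prob_space "inputs :: (nat \<times> bool \<Rightarrow> 'e) measure" by (rule prob_space_inputs)
  have gs_meas [measurable]: "(\<lambda>x. g (\<lambda>j. x (s + j))) \<in> borel_measurable inputs" for s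
    by (rule measurable_compose[OF measurable_relabel g_meas])
  define f where "f x = (\<Sum>s<n. g (\<lambda>j. x (s + j)))" for x
  have f_meas [measurable]: "f \<in> borel_measurable inputs"
    unfolding f_def by measurable
  have f: "\<bar>f x\<bar> \<le> real n * K" for x
    using order.trans[OF sum_abs sum_mono[of "{..<n}" _ "\<lambda>_. K"]] g by (simp add: f_def)
  have Ef: "(\<integral>x. f x \<partial>inputs) = real n * (\<integral>x. g x \<partial>inputs)"
  proof -
    have "(\<integral>x. f x \<partial>inputs) = (\<Sum>s<n. \<integral>x. g (\<lambda>j. x (s + j)) \<partial>inputs)"
      unfolding f_def by (intro Bochner_Integration.integral_sum N.integrable_bounded[of _ K]) (auto simp: g)
    also have "\<dots> = (\<Sum>s<n. \<integral>x. g x \<partial>inputs)"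
      by (intro sum.cong refl integral_relabel g_meas) (auto simp: inj_on_def)
    finally show ?thesis by simp
  qed
  \<comment> \<open>Bound for the influence of input \<open>i\<close> on the summand at lag \<open>s\<close>: its row and column sums are at most \<open>suminf d\<close>.\<close>
  define d' where "d' i s = (if s \<le> i then d (i - s) else 0)" for i s :: nat
  have d'0: "0 \<le> d' i s" for i s using d by (simp add: d'_def)
  have sum_inj: "(\<Sum>x\<in>A. d (h x)) \<le> suminf d" if "finite A" "inj_on h A" for h and A :: "nat set"
  proof -
    have "(\<Sum>x\<in>A. d (h x)) = (\<Sum>y\<in>h ` A. d y)" using that by (simp add: sum.reindex)
    also have "\<dots> \<le> suminf d" using that d by (intro sum_le_suminf) auto
    finally show ?thesis .
  qed
  have row: "(\<Sum>s<n. d' i s) \<le> suminf d" for i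
  proof -
    have "(\<Sum>s<n. d' i s) = (\<Sum>s\<in>{s\<in>{..<n}. s \<le> i}. d (i - s))"
      unfolding d'_def by (rule sum.inter_filter[symmetric]) simp
    also have "\<dots> \<le> suminf d" by (rule sum_inj) (auto simp: inj_on_def)
    finally show ?thesis .
  qed
  have col: "(\<Sum>i<m. d' i s) \<le> suminf d" for m s
  proof -
    have "(\<Sum>i<m. d' i s) = (\<Sum>i\<in>{i\<in>{..<m}. s \<le> i}. d (i - s))"
      unfolding d'_def by (rule sum.inter_filter[symmetric]) simp
    also have "\<dots> \<le> suminf d" by (rule sum_inj) (auto simp: inj_on_def)
    finally show ?thesis .
  qed
  define A where "A i s z = g (\<lambda>j. mix {} z (s + j)) - g (\<lambda>j. mix {i} z (s + j))" for i s z
  have A_meas [measurable]: "A i s \<in> borel_measurable inputs" for i s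
    unfolding A_def
    by (intro borel_measurable_diff measurable_compose[OF measurable_mix gs_meas])
  have A2: "\<bar>A i s z\<bar> \<le> 2 * K" for i s z
    using abs_triangle_ineq4[of "g (\<lambda>j. mix {} z (s + j))" "g (\<lambda>j. mix {i} z (s + j))"]
      g[of "\<lambda>j. mix {} z (s + j)"] g[of "\<lambda>j. mix {i} z (s + j)"] by (simp add: A_def)
  have intA: "integrable inputs (\<lambda>z. A i s z * A i t z)" for i s t
  proof (rule Q.integrable_bounded)
    show "\<bar>A i s z * A i t z\<bar> \<le> (2 * K) * (2 * K)" for z
      unfolding abs_mult by (intro mult_mono A2 abs_ge_zero order.trans[OF abs_ge_zero A2])
  qed measurable
  have A_L2: "(\<integral>z. (A i s z)\<^sup>2 \<partial>inputs) \<le> (d' i s)\<^sup>2" for i s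
  proof -
    \<comment> \<open>By stationarity, the summand at lag \<open>s\<close> sees input \<open>i\<close> as input \<open>i - s\<close>.\<close>
    define \<phi> where "\<phi> = (\<lambda>(j::nat, b::bool). (s + j, b))"
    have "inj \<phi>" by (auto simp: \<phi>_def inj_on_def)
    have sh: "(\<lambda>j. mix J z (s + j)) = mix {j. s + j \<in> J} (\<lambda>p. z (\<phi> p))" for J z
      by (simp add: mix_def \<phi>_def)
    have "(\<integral>z. (A i s z)\<^sup>2 \<partial>inputs)
        = (\<integral>z. (g (mix {} (\<lambda>p. z (\<phi> p))) - g (mix {j. s + j = i} (\<lambda>p. z (\<phi> p))))\<^sup>2 \<partial>inputs)"
      unfolding A_def sh by simp
    also have "\<dots> = (\<integral>z. (g (mix {} z) - g (mix {j. s + j = i} z))\<^sup>2 \<partial>inputs)"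
      by (rule integral_relabel[OF \<open>inj \<phi>\<close>]) measurable
    also have "\<dots> \<le> (d' i s)\<^sup>2"
    proof (cases "s \<le> i")
      case True
      then have "{j. s + j = i} = {i - s}" by auto
      then show ?thesis using infl[of "i - s"] True by (simp add: d'_def)
    next
      case False
      then have "{j. s + j = i} = {}" by auto
      then show ?thesis by simp
    qed
    finally show ?thesis .
  qed
  have inflf: "(\<integral>z. (f (mix {} z) - f (mix {i} z))\<^sup>2 \<partial>inputs) \<le> (\<Sum>s<n. d' i s)\<^sup>2" for i
  proof -
    have "(f (mix {} z) - f (mix {i} z))\<^sup>2 = (\<Sum>s<n. \<Sum>t<n. A i s z * A i t z)" for z
      by (simp add: f_def A_def power2_eq_square sum_product flip: sum_subtractf)
    then have "(\<integral>z. (f (mix {} z) - f (mix {i} z))\<^sup>2 \<partial>inputs) = (\<Sum>s<n. \<Sum>t<n. \<integral>z. A i s z * A i t z \<partial>inputs)"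
      by (simp add: Bochner_Integration.integral_sum Bochner_Integration.integrable_sum intA)
    also have "\<dots> \<le> (\<Sum>s<n. \<Sum>t<n. d' i s * d' i t)"
      using intA by (intro sum_mono integral_mult_le_L2 A_L2 d'0) (auto simp: power2_eq_square)
    finally show ?thesis by (simp add: power2_eq_square sum_product)
  qed
  have "(\<Sum>i<m. \<integral>z. (f (mix {} z) - f (mix {i} z))\<^sup>2 \<partial>inputs) \<le> real n * (suminf d)\<^sup>2" for m
  proof -
    have "(\<Sum>i<m. \<integral>z. (f (mix {} z) - f (mix {i} z))\<^sup>2 \<partial>inputs) \<le> (\<Sum>i<m. suminf d * (\<Sum>s<n. d' i s))"
    proof (rule sum_mono)
      fix i
      have "(\<Sum>s<n. d' i s)\<^sup>2 \<le> suminf d * (\<Sum>s<n. d' i s)"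
        unfolding power2_eq_square by (intro mult_right_mono row sum_nonneg d'0)
      with inflf[of i] show "(\<integral>z. (f (mix {} z) - f (mix {i} z))\<^sup>2 \<partial>inputs) \<le> suminf d * (\<Sum>s<n. d' i s)" by linarith
    qed
    also have "\<dots> = suminf d * (\<Sum>s<n. \<Sum>i<m. d' i s)"
      by (simp add: sum.swap[of _ "{..<n}"] flip: sum_distrib_left)
    also have "\<dots> \<le> suminf d * (\<Sum>s<n. suminf d)"
      by (intro mult_left_mono sum_mono col suminf_nonneg d)
    finally show ?thesis by (simp add: power2_eq_square mult_ac)
  qed
  from efron_stein[OF f_meas f this] show ?thesis
    by (simp add: Ef) (simp add: f_def sum_subtractf)
qed

end

text \<open>Independence of two random variables is stated for a common codomain; the copy of a single
  innovation is therefore written as a constant sequence, which generates no further events.\<close>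

lemma (in prob_space) indep_copy_imp_indep_var:
  assumes copy: "indep_copy M S eps eps'" and eps [measurable]: "\<And>t. eps t \<in> measurable M S"
  shows "indep_var (PiM UNIV (\<lambda>_. S)) (\<lambda>\<omega> t. eps t \<omega>) (PiM UNIV (\<lambda>_::int. S)) (\<lambda>\<omega> _. eps' \<omega>)"
proof -
  have [measurable]: "eps' \<in> measurable M S" using copy by (simp add: indep_copy_def)
  have const [measurable]: "(\<lambda>y _. y) \<in> measurable S (PiM UNIV (\<lambda>_::int. S))"
    by (intro measurable_PiM_single') auto
  have all_meas: "(\<lambda>\<omega> t. eps t \<omega>) \<in> measurable M (PiM UNIV (\<lambda>_. S))"
    by (intro measurable_PiM_single') (auto intro: measurable_space[OF eps])
  have const_meas: "(\<lambda>\<omega> _. eps' \<omega>) \<in> measurable M (PiM UNIV (\<lambda>_::int. S))"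
    by measurable
  let ?X = "vimage_algebra (space M) eps' S"
  let ?X' = "vimage_algebra (space M) (\<lambda>\<omega> _::int. eps' \<omega>) (PiM UNIV (\<lambda>_. S))"
  let ?Y = "vimage_algebra (space M) (\<lambda>\<omega> t. eps t \<omega>) (PiM UNIV (\<lambda>_. S))"
  have sub: "sets ?X' \<subseteq> sets ?X"
  proof
    fix B assume "B \<in> sets ?X'"
    then obtain A where A: "A \<in> sets (PiM UNIV (\<lambda>_::int. S))" "B = (\<lambda>\<omega> _. eps' \<omega>) -` A \<inter> space M"
      using sets_vimage_algebra2[of "\<lambda>\<omega> _. eps' \<omega>" "space M" "PiM UNIV (\<lambda>_::int. S)"] measurable_space[OF const_meas]
      by auto
    moreover have "(\<lambda>y _. y) -` A \<inter> space S \<in> sets S" using A(1) by measurable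
    ultimately show "B \<in> sets ?X"
      using measurable_space[of eps' M S]
      by (subst sets_vimage_algebra2) (auto intro!: exI[of _ "(\<lambda>y _. y) -` A \<inter> space S"])
  qed
  have "indep_set (sets ?X) (sets ?Y)" using copy by (simp add: indep_copy_def)
  then have "indep_set (sets ?X') (sets ?Y)"
    unfolding indep_set_def by (rule indep_sets_mono_sets) (use sub in \<open>auto split: bool.splits\<close>)
  then have "indep_set (sets ?Y) (sets ?X')"
    unfolding indep_set_def indep_sets2_eq[unfolded indep_set_def]
    by (metis inf_commute mult.commute)
  then show ?thesis
    unfolding indep_var_eq using all_meas const_meas by (simp add: sets_vimage_algebra)
qed

text \<open>The same bound on the space that carries the process. Only the joint law of the past and one
  replaced innovation is involved, and this law is the one of the sequence and one entry of its copy in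
  the array of inputs. The truncation at \<open>w\<close> expresses that the influence of an innovation on \<open>g\<close>
  cannot exceed twice the \<open>L\<^sup>2\<close> norm of \<open>g\<close>; it is what makes increments over short intervals small.\<close>

lemma (in prob_space) variance_sum_past_le:
  fixes g :: "(nat \<Rightarrow> 'e) \<Rightarrow> real" and d :: "nat \<Rightarrow> real"
  assumes iid: "iid M S eps" and copy: "indep_copy M S eps eps'"
    and g_meas: "g \<in> borel_measurable (PiM UNIV (\<lambda>_. S))" and g: "\<And>x. \<bar>g x\<bar> \<le> K"
    and d: "\<And>k. 0 \<le> d k" "summable d"
    and w: "0 \<le> w" "4 * expectation (\<lambda>\<omega>. (g (past eps 0 \<omega>))\<^sup>2) \<le> w\<^sup>2"
    and dep: "\<And>k. expectation (\<lambda>\<omega>. (g (past eps (int k) \<omega>) - g (past (eps(0 := eps')) (int k) \<omega>))\<^sup>2) \<le> (d k)\<^sup>2"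
  shows "expectation (\<lambda>\<omega>. (\<Sum>t = 1..n. g (past eps (int t) \<omega>) - expectation (\<lambda>\<omega>. g (past eps 0 \<omega>)))\<^sup>2)
    \<le> real n * (\<Sum>k. min (d k) w)\<^sup>2 / 2"
proof -
  define D where "D = distr M S (eps 0)"
  have ind: "indep_vars (\<lambda>_. S) eps UNIV" and D: "distr M S (eps t) = D" for t
    using iid by (simp_all add: iid_def D_def)
  have eps [measurable]: "eps t \<in> measurable M S" for t
    using ind unfolding indep_vars_def by auto
  interpret D: prob_space D unfolding D_def by (rule prob_space_distr) measurable
  interpret input_law D ..
  have sets_D [measurable_cong]: "sets D = sets S" by (simp add: D_def)
  have sets_I: "sets (inputs :: ('i \<Rightarrow> 'e) measure) = sets (PiM UNIV (\<lambda>_. S))"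
    by (intro sets_PiM_cong) (simp_all add: sets_D)
  have g_meas' [measurable]: "g \<in> borel_measurable inputs"
    using g_meas by (simp add: measurable_cong_sets[OF sets_I refl])
  have past [measurable]: "past eps t \<in> measurable M (PiM UNIV (\<lambda>_. S))" for t
    unfolding past_def by (intro measurable_PiM_single') (auto intro: measurable_space[OF eps])
  have distr_past: "distr M (PiM UNIV (\<lambda>_. S)) (past eps t) = inputs" for t
  proof -
    have all_meas: "(\<lambda>\<omega> s. eps s \<omega>) \<in> measurable M (PiM UNIV (\<lambda>_. S))"
      by (intro measurable_PiM_single') (auto intro: measurable_space[OF eps])
    have all: "distr M (PiM UNIV (\<lambda>_. S)) (\<lambda>\<omega> s. eps s \<omega>) = inputs"
      using ind by (subst (asm) indep_vars_iff_distr_eq_PiM) (auto simp: D restrict_UNIV)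
    have "inputs = distr inputs inputs (\<lambda>z j. z (t - int j))"
      by (rule distr_relabel[symmetric]) (auto simp: inj_on_def)
    also have "\<dots> = distr (distr M (PiM UNIV (\<lambda>_. S)) (\<lambda>\<omega> s. eps s \<omega>)) (PiM UNIV (\<lambda>_. S)) (\<lambda>z j. z (t - int j))"
      by (rule distr_cong) (simp_all add: all sets_I)
    also have "\<dots> = distr M (PiM UNIV (\<lambda>_. S)) (past eps t)"
      by (subst distr_distr[OF _ all_meas])
         (auto simp: comp_def past_def[abs_def] space_PiM PiE_iff intro!: measurable_PiM_single')
    finally show ?thesis by simp
  qed
  have integral_past: "expectation (\<lambda>\<omega>. h (past eps t \<omega>)) = (\<integral>x. h x \<partial>inputs)"
    if "h \<in> borel_measurable inputs" for h :: "(nat \<Rightarrow> 'e) \<Rightarrow> real" and t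
    using that integral_distr[of "past eps t" M "PiM UNIV (\<lambda>_. S)" h]
    by (simp add: distr_past measurable_cong_sets[OF sets_I refl])
  have infl_d: "(\<integral>z. (g (mix {} z) - g (mix {k} z))\<^sup>2 \<partial>inputs) \<le> (d k)\<^sup>2" for k
  proof -
    interpret Q: prob_space "inputs :: (nat \<times> bool \<Rightarrow> 'e) measure" by (rule prob_space_inputs)
    define C :: "(nat \<Rightarrow> 'e) measure" where "C = distr D inputs (\<lambda>y _. y)"
    have const [measurable]: "(\<lambda>y _. y) \<in> measurable D (inputs :: (nat \<Rightarrow> 'e) measure)"
      by (intro measurable_PiM_single') auto
    have sets_C [measurable_cong]: "sets C = sets inputs" by (simp add: C_def)
    have [measurable]: "eps' \<in> measurable M S" and eps'_law: "distr M S eps' = D"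
      using copy by (simp_all add: indep_copy_def D_def)
    have sets_II: "sets (inputs \<Otimes>\<^sub>M inputs :: ((nat \<Rightarrow> 'e) \<times> (nat \<Rightarrow> 'e)) measure) = sets (PiM UNIV (\<lambda>_. S) \<Otimes>\<^sub>M PiM UNIV (\<lambda>_. S))"
      by (intro sets_pair_measure_cong sets_I)
    define h where "h = (\<lambda>(x :: nat \<Rightarrow> 'e, y :: nat \<Rightarrow> 'e). (g x - g (x(k := y 0)))\<^sup>2)"
    have h_meas [measurable]: "h \<in> borel_measurable (inputs \<Otimes>\<^sub>M inputs)"
    proof -
      have [measurable]: "(\<lambda>p. (fst p)(k := snd p 0)) \<in> measurable (inputs \<Otimes>\<^sub>M inputs) inputs"
        by (rule measurable_fun_upd[where J=UNIV]) auto
      show ?thesis unfolding h_def case_prod_beta by measurable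
    qed
    have h_meas': "h \<in> borel_measurable (PiM UNIV (\<lambda>_. S) \<Otimes>\<^sub>M PiM UNIV (\<lambda>_. S))"
      using h_meas by (subst (asm) measurable_cong_sets[OF sets_II refl])
    have indM: "indep_var (PiM UNIV (\<lambda>_. S)) (past eps (int k)) (PiM UNIV (\<lambda>_::nat. S)) (\<lambda>\<omega> _. eps' \<omega>)"
    proof -
      have "(\<lambda>e j. e (\<phi> j)) \<in> measurable (PiM UNIV (\<lambda>_::int. S)) (PiM UNIV (\<lambda>_::nat. S))" for \<phi>
        by (intro measurable_PiM_single') (auto simp: space_PiM PiE_iff)
      from indep_var_compose[OF indep_copy_imp_indep_var[OF copy eps] this[of "\<lambda>j. int k - int j"] this[of "\<lambda>j. int j"]]
      show ?thesis by (simp add: comp_def past_def[abs_def])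
    qed
    have lawM: "distr M (PiM UNIV (\<lambda>_. S) \<Otimes>\<^sub>M PiM UNIV (\<lambda>_. S)) (\<lambda>\<omega>. (past eps (int k) \<omega>, \<lambda>_. eps' \<omega>)) = inputs \<Otimes>\<^sub>M C"
    proof -
      have cS: "(\<lambda>y _. y) \<in> measurable S (PiM UNIV (\<lambda>_::nat. S))"
        by (intro measurable_PiM_single') auto
      have "C = distr (distr M S eps') (PiM UNIV (\<lambda>_. S)) (\<lambda>y _. y)"
        unfolding C_def eps'_law by (intro distr_cong) (simp_all add: sets_I)
      also have "\<dots> = distr M (PiM UNIV (\<lambda>_. S)) (\<lambda>\<omega> _. eps' \<omega>)"
        by (subst distr_distr[OF cS]) (simp_all add: comp_def)
      finally show ?thesis
        using indM unfolding indep_var_distribution_eq by (simp add: distr_past)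
    qed
    have indQ: "Q.indep_var inputs (mix {}) inputs (\<lambda>z _. z (k, True))"
    proof -
      have "(\<lambda>x j. x k) \<in> measurable (inputs :: (nat \<Rightarrow> 'e) measure) (inputs :: (nat \<Rightarrow> 'e) measure)"
        by (rule measurable_relabel)
      from Q.indep_var_compose[OF indep_mix measurable_id this]
      show ?thesis by (simp add: comp_def id_def mix_def[abs_def])
    qed
    have lawQ: "distr inputs (inputs \<Otimes>\<^sub>M inputs) (\<lambda>z. (mix {} z, \<lambda>_. z (k, True))) = inputs \<Otimes>\<^sub>M C"
    proof -
      have "C = distr (distr inputs D (\<lambda>z :: nat \<times> bool \<Rightarrow> 'e. z (k, True))) inputs (\<lambda>y _. y)"
        using distr_PiM_component[of UNIV "\<lambda>_. D" "(k, True)"] by (simp add: C_def D.prob_space_axioms)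
      also have "\<dots> = distr inputs inputs (\<lambda>z _. z (k, True))"
        by (subst distr_distr[OF const]) (simp_all add: comp_def)
      finally show ?thesis
        using indQ unfolding Q.indep_var_distribution_eq by (simp add: distr_mix)
    qed
    have "(\<integral>z. (g (mix {} z) - g (mix {k} z))\<^sup>2 \<partial>inputs) = (\<integral>z. h (mix {} z, \<lambda>_. z (k, True)) \<partial>inputs)"
    proof -
      have "mix {k} z = (mix {} z)(k := z (k, True))" for z :: "nat \<times> bool \<Rightarrow> 'e"
        by (auto simp: mix_def)
      then show ?thesis by (simp add: h_def)
    qed
    also have "\<dots> = (\<integral>p. h p \<partial>(inputs \<Otimes>\<^sub>M C))"
    proof -
      have "(\<lambda>z. (mix {} z, \<lambda>_::nat. z (k, True))) \<in> measurable inputs (inputs \<Otimes>\<^sub>M inputs)"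
        using measurable_relabel[of "\<lambda>_::nat. (k, True)"] by (intro measurable_Pair measurable_mix)
      from integral_distr[OF this h_meas] show ?thesis by (simp add: lawQ)
    qed
    also have "\<dots> = expectation (\<lambda>\<omega>. h (past eps (int k) \<omega>, \<lambda>_. eps' \<omega>))"
    proof -
      have "(\<lambda>\<omega>. (past eps (int k) \<omega>, \<lambda>_. eps' \<omega>)) \<in> measurable M (PiM UNIV (\<lambda>_. S) \<Otimes>\<^sub>M PiM UNIV (\<lambda>_::nat. S))"
        by (intro measurable_Pair past measurable_PiM_single') (auto intro: measurable_space[of eps' M S])
      from integral_distr[OF this h_meas'] show ?thesis by (simp add: lawM)
    qed
    also have "\<dots> = expectation (\<lambda>\<omega>. (g (past eps (int k) \<omega>) - g (past (eps(0 := eps')) (int k) \<omega>))\<^sup>2)"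
    proof -
      have "(past eps (int k) \<omega>)(k := eps' \<omega>) = past (eps(0 := eps')) (int k) \<omega>" for \<omega>
        by (auto simp: past_def)
      then show ?thesis by (simp add: h_def)
    qed
    also have "\<dots> \<le> (d k)\<^sup>2" by (rule dep)
    finally show ?thesis .
  qed
  have infl_w: "(\<integral>z. (g (mix {} z) - g (mix {k} z))\<^sup>2 \<partial>inputs) \<le> w\<^sup>2" for k
  proof -
    interpret Q: prob_space "inputs :: (nat \<times> bool \<Rightarrow> 'e) measure" by (rule prob_space_inputs)
    have gb: "\<bar>g x * g y\<bar> \<le> K * K" for x y
      using g[of x] g[of y] unfolding abs_mult by (intro mult_mono) auto
    have int: "integrable inputs (\<lambda>z. g (mix J z) * g (mix J' z))" for J J'
      by (rule Q.integrable_bounded[of _ "K * K"]) (use gb in auto)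
    have "(\<integral>z. (g (mix {} z) - g (mix {k} z))\<^sup>2 \<partial>inputs)
        \<le> (\<integral>z. 2 * (g (mix {} z) * g (mix {} z)) + 2 * (g (mix {k} z) * g (mix {k} z)) \<partial>inputs)"
    proof (rule integral_mono)
      show "integrable inputs (\<lambda>z. (g (mix {} z) - g (mix {k} z))\<^sup>2)"
        using int by (simp add: power2_eq_square algebra_simps)
      show "(a - b)\<^sup>2 \<le> 2 * (a * a) + 2 * (b * b)" for a b :: real
        using zero_le_power2[of "a + b"] by (simp add: power2_eq_square algebra_simps)
    qed (use int in simp)
    also have "\<dots> = 4 * (\<integral>x. (g x)\<^sup>2 \<partial>inputs)"
      using int integral_mix[of "\<lambda>x. g x * g x"] by (simp add: power2_eq_square)
    also have "\<dots> \<le> w\<^sup>2" using w(2) integral_past[of "\<lambda>x. (g x)\<^sup>2" 0] by simp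
    finally show ?thesis .
  qed
  have infl: "(\<integral>z. (g (mix {} z) - g (mix {k} z))\<^sup>2 \<partial>inputs) \<le> (min (d k) w)\<^sup>2" for k
    using infl_d[of k] infl_w[of k] by (simp add: min_def)
  have min_d: "0 \<le> min (d k) w" "summable (\<lambda>k. min (d k) w)" for k
    using d w by (auto intro!: summable_comparison_test'[OF d(2)])
  \<comment> \<open>Time \<open>t\<close> corresponds to lag \<open>n - t\<close> from the last time \<open>n\<close>.\<close>
  have rev: "(\<Sum>t = 1..n. g (past eps (int t) \<omega>) - c) = (\<Sum>s<n. g (\<lambda>j. past eps (int n) \<omega> (s + j)) - c)" for \<omega> c
    by (rule sum.reindex_bij_witness[of _ "\<lambda>s. n - s" "\<lambda>t. n - t"])
       (auto simp: past_def of_nat_diff algebra_simps)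
  have "(\<lambda>x. (\<Sum>s<n. g (\<lambda>j. x (s + j)) - (\<integral>x. g x \<partial>inputs))\<^sup>2) \<in> borel_measurable inputs"
    by (intro borel_measurable_power borel_measurable_sum borel_measurable_diff
        measurable_compose[OF measurable_relabel g_meas']) auto
  from integral_past[OF this, of "int n"] variance_shift_sum_le[OF g_meas' g min_d infl, of n]
  show ?thesis unfolding rev integral_past[OF g_meas'] by simp
qed

section \<open>Comparison in probability\<close>

definition vanishes_in_prob :: "'a measure \<Rightarrow> (nat \<Rightarrow> 'a \<Rightarrow> real) \<Rightarrow> bool" where
  "vanishes_in_prob M R \<longleftrightarrow> (\<forall>\<delta>>0. (\<lambda>n. measure M {\<omega> \<in> space M. \<bar>R n \<omega>\<bar> > \<delta>}) \<longlonglongrightarrow> 0)"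

definition bounded_in_prob :: "'a measure \<Rightarrow> (nat \<Rightarrow> 'a \<Rightarrow> real) \<Rightarrow> bool" where
  "bounded_in_prob M R \<longleftrightarrow> (\<forall>\<eta>>0. \<exists>L>0. \<forall>n. measure M {\<omega> \<in> space M. \<bar>R n \<omega>\<bar> > L} \<le> \<eta>)"

lemma (in prob_space) prob_abs_gt_le:
  assumes R: "R \<in> borel_measurable M" and int: "integrable M (\<lambda>\<omega>. (R \<omega>)\<^sup>2)"
    and le: "expectation (\<lambda>\<omega>. (R \<omega>)\<^sup>2) \<le> s" and "\<delta> > 0"
  shows "prob {\<omega> \<in> space M. \<bar>R \<omega>\<bar> > \<delta>} \<le> s / \<delta>\<^sup>2"
proof -
  have "prob {\<omega> \<in> space M. \<bar>R \<omega>\<bar> > \<delta>} \<le> prob {\<omega> \<in> space M. \<delta>\<^sup>2 \<le> (R \<omega>)\<^sup>2}"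
  proof (rule finite_measure_mono)
    show "{\<omega> \<in> space M. \<bar>R \<omega>\<bar> > \<delta>} \<subseteq> {\<omega> \<in> space M. \<delta>\<^sup>2 \<le> (R \<omega>)\<^sup>2}"
      using \<open>\<delta> > 0\<close> by (auto simp: abs_le_square_iff[symmetric])
  qed (use R in measurable)
  also have "\<dots> \<le> expectation (\<lambda>\<omega>. (R \<omega>)\<^sup>2) / \<delta>\<^sup>2"
    by (rule integral_Markov_inequality_measure[OF int sets.empty_sets]) (use \<open>\<delta> > 0\<close> in auto)
  also have "\<dots> \<le> s / \<delta>\<^sup>2" using le by (intro divide_right_mono) auto
  finally show ?thesis .
qed

lemma (in prob_space) vanishes_in_probI_L2:
  assumes R: "\<And>n. R n \<in> borel_measurable M" and int: "\<And>n. integrable M (\<lambda>\<omega>. (R n \<omega>)\<^sup>2)"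
    and le: "\<forall>\<^sub>F n in sequentially. expectation (\<lambda>\<omega>. (R n \<omega>)\<^sup>2) \<le> s n" and s: "s \<longlonglongrightarrow> 0"
  shows "vanishes_in_prob M R"
  unfolding vanishes_in_prob_def
proof (intro allI impI)
  fix \<delta> :: real assume "\<delta> > 0"
  show "(\<lambda>n. prob {\<omega> \<in> space M. \<bar>R n \<omega>\<bar> > \<delta>}) \<longlonglongrightarrow> 0"
  proof (rule tendsto_sandwich[of "\<lambda>_. 0"])
    show "\<forall>\<^sub>F n in sequentially. prob {\<omega> \<in> space M. \<bar>R n \<omega>\<bar> > \<delta>} \<le> s n / \<delta>\<^sup>2"
      using le by eventually_elim (intro prob_abs_gt_le R int \<open>\<delta> > 0\<close>)
    show "(\<lambda>n. s n / \<delta>\<^sup>2) \<longlonglongrightarrow> 0"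
      using tendsto_divide[OF s tendsto_const, of "\<delta>\<^sup>2"] \<open>\<delta> > 0\<close> by simp
  qed auto
qed

lemma (in prob_space) bounded_in_probI_L2:
  assumes R: "\<And>n. R n \<in> borel_measurable M" and int: "\<And>n. integrable M (\<lambda>\<omega>. (R n \<omega>)\<^sup>2)"
    and le: "\<And>n. expectation (\<lambda>\<omega>. (R n \<omega>)\<^sup>2) \<le> s"
  shows "bounded_in_prob M R"
  unfolding bounded_in_prob_def
proof (intro allI impI)
  fix \<eta> :: real assume \<eta>: "\<eta> > 0"
  have s: "s \<ge> 0" using order.trans[OF integral_nonneg_AE le[of 0]] by simp
  define L where "L = sqrt (s / \<eta>) + 1"
  have L: "L > 0" using s \<eta> by (simp add: L_def add_nonneg_pos)
  have "s / \<eta> \<le> L\<^sup>2"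
  proof -
    have "(sqrt (s / \<eta>))\<^sup>2 \<le> L\<^sup>2" unfolding L_def using s \<eta> by (intro power_mono) auto
    then show ?thesis using s \<eta> by simp
  qed
  then have "s / L\<^sup>2 \<le> \<eta>" using L \<eta> by (simp add: field_simps)
  then show "\<exists>L>0. \<forall>n. prob {\<omega> \<in> space M. \<bar>R n \<omega>\<bar> > L} \<le> \<eta>"
    using L prob_abs_gt_le[OF R int le L] order.trans by blast
qed

text \<open>Ghosh's lemma: it is enough to compare at fixed levels. If \<open>A\<close> and \<open>B\<close> differ by more than \<open>\<delta>\<close> and \<open>B\<close> stays in
  a bounded interval, some point \<open>y\<close> of a finite grid of mesh \<open>\<delta> / 3\<close> separates them, and separation at \<open>y\<close>
  has small probability since \<open>{A \<le> y}\<close> is an event about a variable \<open>Z\<close> close to \<open>B\<close>. For a sample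
  quantile \<open>A\<close>, this replaces uniform control of the empirical process by control of
  single increments.\<close>

lemma (in prob_space) ghosh_comparison:
  assumes A [measurable]: "\<And>n. A n \<in> borel_measurable M" and B [measurable]: "\<And>n. B n \<in> borel_measurable M"
    and bdd: "bounded_in_prob M B"
    and level: "\<And>y. \<exists>Z c. (\<forall>n. Z n \<in> borel_measurable M) \<and> c \<longlonglongrightarrow> y \<and>
      (\<forall>\<^sub>F n in sequentially. \<forall>\<omega>\<in>space M. A n \<omega> \<le> y \<longleftrightarrow> Z n \<omega> \<le> c n) \<and>
      vanishes_in_prob M (\<lambda>n \<omega>. Z n \<omega> - B n \<omega>)"
  shows "vanishes_in_prob M (\<lambda>n \<omega>. A n \<omega> - B n \<omega>)"
  unfolding vanishes_in_prob_def
proof (intro allI impI)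
  fix \<delta> :: real assume \<delta>: "\<delta> > 0"
  define s where "s = \<delta> / 3"
  have s: "s > 0" using \<delta> by (simp add: s_def)
  define E where "E n y = {\<omega> \<in> space M. (A n \<omega> \<le> y \<and> y + s \<le> B n \<omega>) \<or> (y < A n \<omega> \<and> B n \<omega> \<le> y - s)}" for n y
  have E_meas [measurable]: "E n y \<in> events" for n y unfolding E_def by measurable
  have E0: "(\<lambda>n. prob (E n y)) \<longlonglongrightarrow> 0" for y
  proof -
    from level[of y] obtain Z c where Z [measurable]: "\<And>n. Z n \<in> borel_measurable M" and c: "c \<longlonglongrightarrow> y"
      and iff: "\<forall>\<^sub>F n in sequentially. \<forall>\<omega>\<in>space M. A n \<omega> \<le> y \<longleftrightarrow> Z n \<omega> \<le> c n"
      and van: "vanishes_in_prob M (\<lambda>n \<omega>. Z n \<omega> - B n \<omega>)" by blast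
    have near: "\<forall>\<^sub>F n in sequentially. \<bar>c n - y\<bar> < s / 4"
      using tendstoD[OF c, of "s / 4"] s by (simp add: dist_real_def)
    show ?thesis
    proof (rule tendsto_sandwich[of "\<lambda>_. 0"])
      show "\<forall>\<^sub>F n in sequentially. prob (E n y) \<le> prob {\<omega> \<in> space M. \<bar>Z n \<omega> - B n \<omega>\<bar> > s / 2}"
        using near iff
      proof eventually_elim
        case (elim n)
        have "E n y \<subseteq> {\<omega> \<in> space M. \<bar>Z n \<omega> - B n \<omega>\<bar> > s / 2}"
        proof
          fix \<omega> assume "\<omega> \<in> E n y"
          then have \<omega>: "\<omega> \<in> space M" and "(A n \<omega> \<le> y \<and> y + s \<le> B n \<omega>) \<or> (y < A n \<omega> \<and> B n \<omega> \<le> y - s)"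
            by (auto simp: E_def)
          then have "(Z n \<omega> \<le> c n \<and> y + s \<le> B n \<omega>) \<or> (c n < Z n \<omega> \<and> B n \<omega> \<le> y - s)"
            using elim(2) by (auto simp: not_le[symmetric])
          then have "\<bar>Z n \<omega> - B n \<omega>\<bar> > s / 2" using elim(1) s by linarith
          then show "\<omega> \<in> {\<omega> \<in> space M. \<bar>Z n \<omega> - B n \<omega>\<bar> > s / 2}" using \<omega> by simp
        qed
        then show ?case by (rule finite_measure_mono) measurable
      qed
      show "(\<lambda>n. prob {\<omega> \<in> space M. \<bar>Z n \<omega> - B n \<omega>\<bar> > s / 2}) \<longlonglongrightarrow> 0"
        by (rule van[unfolded vanishes_in_prob_def, rule_format]) (use s in simp)
    qed auto
  qed
  show "(\<lambda>n. prob {\<omega> \<in> space M. \<bar>A n \<omega> - B n \<omega>\<bar> > \<delta>}) \<longlonglongrightarrow> 0"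
  proof (rule tendstoI)
    fix \<eta> :: real assume \<eta>: "\<eta> > 0"
    from bdd \<eta> obtain L where L: "\<And>n. prob {\<omega> \<in> space M. \<bar>B n \<omega>\<bar> > L} \<le> \<eta> / 2"
      unfolding bounded_in_prob_def by (metis half_gt_zero)
    define I where "I = {- (\<lceil>L / s\<rceil> + 3) .. \<lceil>L / s\<rceil> + 3}"
    have fin: "finite I" by (simp add: I_def)
    have "(\<lambda>n. \<Sum>i\<in>I. prob (E n (s * real_of_int i))) \<longlonglongrightarrow> 0"
      using tendsto_sum[of I "\<lambda>i n. prob (E n (s * real_of_int i))" "\<lambda>_. 0" sequentially] E0 by simp
    then have "\<forall>\<^sub>F n in sequentially. (\<Sum>i\<in>I. prob (E n (s * real_of_int i))) < \<eta> / 2"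
      using \<eta> by (intro order_tendstoD) auto
    then show "\<forall>\<^sub>F n in sequentially. dist (prob {\<omega> \<in> space M. \<bar>A n \<omega> - B n \<omega>\<bar> > \<delta>}) 0 < \<eta>"
    proof eventually_elim
      case (elim n)
      have "{\<omega> \<in> space M. \<bar>A n \<omega> - B n \<omega>\<bar> > \<delta>}
          \<subseteq> {\<omega> \<in> space M. \<bar>B n \<omega>\<bar> > L} \<union> (\<Union>i\<in>I. E n (s * real_of_int i))"
      proof
        fix \<omega> assume "\<omega> \<in> {\<omega> \<in> space M. \<bar>A n \<omega> - B n \<omega>\<bar> > \<delta>}"
        then have \<omega>: "\<omega> \<in> space M" and far: "\<bar>A n \<omega> - B n \<omega>\<bar> > 3 * s" by (auto simp: s_def)
        show "\<omega> \<in> {\<omega> \<in> space M. \<bar>B n \<omega>\<bar> > L} \<union> (\<Union>i\<in>I. E n (s * real_of_int i))"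
        proof (cases "\<bar>B n \<omega>\<bar> > L")
          case False
          \<comment> \<open>\<open>B\<close> lies in the cell between \<open>s j\<close> and \<open>s (j + 1)\<close>; the separating grid point is one full mesh away from
              this cell, so that \<open>B\<close> is beyond it by at least \<open>s\<close>.\<close>
          define j where "j = \<lfloor>B n \<omega> / s\<rfloor>"
          have j: "real_of_int j \<le> B n \<omega> / s" "B n \<omega> / s < real_of_int j + 1"
            unfolding j_def by linarith+
          then have j': "s * real_of_int j \<le> B n \<omega>" "B n \<omega> < s * real_of_int j + s"
            using s by (simp_all add: field_simps)
          have "\<bar>B n \<omega> / s\<bar> \<le> L / s" using False s by (simp add: divide_right_mono)
          then have jI: "j + 2 \<in> I" "j - 1 \<in> I" using j unfolding I_def by (auto simp: abs_le_iff; linarith)+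
          show ?thesis
          proof (cases "A n \<omega> > B n \<omega>")
            case True
            then have "\<omega> \<in> E n (s * real_of_int (j + 2))"
              using far j' \<omega> s by (auto simp: E_def algebra_simps)
            then show ?thesis using jI by blast
          next
            case False
            then have "\<omega> \<in> E n (s * real_of_int (j - 1))"
              using far j' \<omega> s by (auto simp: E_def algebra_simps)
            then show ?thesis using jI by blast
          qed
        qed (use \<omega> in auto)
      qed
      then have "prob {\<omega> \<in> space M. \<bar>A n \<omega> - B n \<omega>\<bar> > \<delta>}
         \<le> prob ({\<omega> \<in> space M. \<bar>B n \<omega>\<bar> > L} \<union> (\<Union>i\<in>I. E n (s * real_of_int i)))"
        using fin by (intro finite_measure_mono) auto
      also have "\<dots> \<le> prob {\<omega> \<in> space M. \<bar>B n \<omega>\<bar> > L} + prob (\<Union>i\<in>I. E n (s * real_of_int i))"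
        using fin by (intro measure_Un_le) auto
      also have "\<dots> \<le> \<eta> / 2 + (\<Sum>i\<in>I. prob (E n (s * real_of_int i)))"
        using fin by (intro add_mono L measure_UNION_le) auto
      finally show ?case using elim by simp
    qed
  qed
qed

text \<open>The delta method: \<open>A\<close> inherits boundedness in probability from \<open>B\<close>, so \<open>A / sqrt n\<close> falls in any neighbourhood
  of 0 with high probability, and there \<open>F\<close> is nearly linear.\<close>

lemma (in prob_space) linearize_in_prob:
  assumes A [measurable]: "\<And>n. A n \<in> borel_measurable M" and B [measurable]: "\<And>n. B n \<in> borel_measurable M"
    and bdd: "bounded_in_prob M B" and AB: "vanishes_in_prob M (\<lambda>n \<omega>. A n \<omega> - B n \<omega>)"
    and F: "(F has_real_derivative c) (at q)"
  shows "vanishes_in_prob M (\<lambda>n \<omega>. sqrt (real n) * (F (q + A n \<omega> / sqrt (real n)) - F q) - c * B n \<omega>)"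
  unfolding vanishes_in_prob_def
proof (intro allI impI tendstoI)
  fix \<delta> \<eta> :: real assume \<delta>: "\<delta> > 0" and \<eta>: "\<eta> > 0"
  from bdd \<eta> obtain L where L0: "L > 0" and L: "\<And>n. prob {\<omega> \<in> space M. \<bar>B n \<omega>\<bar> > L} \<le> \<eta> / 2"
    unfolding bounded_in_prob_def by (metis half_gt_zero)
  define \<rho> where "\<rho> = min 1 ((\<delta> / 2) / (\<bar>c\<bar> + 1))"
  have \<rho>: "\<rho> > 0" "\<rho> \<le> 1" "\<bar>c\<bar> * \<rho> \<le> \<delta> / 2"
  proof -
    show "\<rho> > 0" "\<rho> \<le> 1" using \<delta> by (auto simp: \<rho>_def)
    have "\<bar>c\<bar> * \<rho> \<le> (\<bar>c\<bar> + 1) * ((\<delta> / 2) / (\<bar>c\<bar> + 1))"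
      using \<open>\<rho> > 0\<close> by (intro mult_mono) (auto simp: \<rho>_def)
    also have "\<dots> = \<delta> / 2"
      by (subst times_divide_eq_right, rule nonzero_mult_div_cancel_left) linarith
    finally show "\<bar>c\<bar> * \<rho> \<le> \<delta> / 2" .
  qed
  define \<epsilon> where "\<epsilon> = (\<delta> / 2) / (L + 1)"
  have \<epsilon>: "\<epsilon> > 0" using \<delta> L0 by (simp add: \<epsilon>_def)
  have \<epsilon>L: "\<epsilon> * (L + 1) = \<delta> / 2"
    unfolding \<epsilon>_def by (subst times_divide_eq_left, rule nonzero_mult_div_cancel_right) (use L0 in linarith)
  obtain d where d: "d > 0" "\<And>x. \<bar>x\<bar> < d \<Longrightarrow> \<bar>F (q + x) - F q - c * x\<bar> \<le> \<epsilon> * \<bar>x\<bar>"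
  proof -
    from F have "(F has_derivative (*) c) (at q)" by (simp add: has_field_derivative_def)
    then obtain d where "d > 0" "\<And>y. norm (y - q) < d \<Longrightarrow> norm (F y - F q - c * (y - q)) \<le> \<epsilon> * norm (y - q)"
      using \<epsilon> unfolding has_derivative_at_alt by blast
    then show ?thesis using that[of d] by (metis add_diff_cancel_left' real_norm_def)
  qed
  have "(\<lambda>n. prob {\<omega> \<in> space M. \<bar>A n \<omega> - B n \<omega>\<bar> > \<rho>}) \<longlonglongrightarrow> 0"
    using AB \<rho> by (simp add: vanishes_in_prob_def)
  then have ev1: "\<forall>\<^sub>F n in sequentially. prob {\<omega> \<in> space M. \<bar>A n \<omega> - B n \<omega>\<bar> > \<rho>} < \<eta> / 2"
    using \<eta> by (intro order_tendstoD) auto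
  have "(\<lambda>n. (L + 1) / sqrt (real n)) \<longlonglongrightarrow> 0" by real_asymp
  then have ev2: "\<forall>\<^sub>F n in sequentially. (L + 1) / sqrt (real n) < d"
    using d(1) by (rule order_tendstoD)
  show "\<forall>\<^sub>F n in sequentially. dist (prob {\<omega> \<in> space M. \<bar>sqrt (real n) * (F (q + A n \<omega> / sqrt (real n)) - F q) - c * B n \<omega>\<bar> > \<delta>}) 0 < \<eta>"
    using ev1 ev2 eventually_gt_at_top[of 0]
  proof eventually_elim
    case (elim n)
    have n: "sqrt (real n) > 0" using elim(3) by simp
    have "{\<omega> \<in> space M. \<bar>sqrt (real n) * (F (q + A n \<omega> / sqrt (real n)) - F q) - c * B n \<omega>\<bar> > \<delta>}
       \<subseteq> {\<omega> \<in> space M. \<bar>B n \<omega>\<bar> > L} \<union> {\<omega> \<in> space M. \<bar>A n \<omega> - B n \<omega>\<bar> > \<rho>}"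
    proof
      fix \<omega> assume "\<omega> \<in> {\<omega> \<in> space M. \<bar>sqrt (real n) * (F (q + A n \<omega> / sqrt (real n)) - F q) - c * B n \<omega>\<bar> > \<delta>}"
      then have \<omega>: "\<omega> \<in> space M" and big: "\<bar>sqrt (real n) * (F (q + A n \<omega> / sqrt (real n)) - F q) - c * B n \<omega>\<bar> > \<delta>" by auto
      have False if BL: "\<bar>B n \<omega>\<bar> \<le> L" and AB\<rho>: "\<bar>A n \<omega> - B n \<omega>\<bar> \<le> \<rho>"
      proof -
        define x where "x = A n \<omega> / sqrt (real n)"
        have AL: "\<bar>A n \<omega>\<bar> \<le> L + 1" using BL AB\<rho> \<rho>(2) by linarith
        have "\<bar>x\<bar> = \<bar>A n \<omega>\<bar> / sqrt (real n)" using n by (simp add: x_def)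
        also have "\<dots> \<le> (L + 1) / sqrt (real n)" using AL n by (intro divide_right_mono) auto
        also have "\<dots> < d" by (rule elim)
        finally have "\<bar>F (q + x) - F q - c * x\<bar> \<le> \<epsilon> * \<bar>x\<bar>" by (rule d)
        then have "sqrt (real n) * \<bar>F (q + x) - F q - c * x\<bar> \<le> sqrt (real n) * (\<epsilon> * \<bar>x\<bar>)"
          using n by (intro mult_left_mono) auto
        also have "\<dots> = \<epsilon> * \<bar>A n \<omega>\<bar>" using n by (simp add: x_def)
        also have "\<dots> \<le> \<delta> / 2" using mult_left_mono[OF AL, of \<epsilon>] \<epsilon> \<epsilon>L by simp
        finally have "\<bar>sqrt (real n) * (F (q + x) - F q - c * x)\<bar> \<le> \<delta> / 2" using n by (simp add: abs_mult)
        moreover have "sqrt (real n) * (F (q + x) - F q) - c * B n \<omega>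
            = sqrt (real n) * (F (q + x) - F q - c * x) + c * (A n \<omega> - B n \<omega>)"
          using n by (simp add: x_def algebra_simps)
        moreover have "\<bar>c * (A n \<omega> - B n \<omega>)\<bar> \<le> \<delta> / 2"
          using \<rho>(3) mult_left_mono[OF AB\<rho>, of "\<bar>c\<bar>"] by (simp add: abs_mult)
        ultimately show False using big unfolding x_def[symmetric] by linarith
      qed
      then show "\<omega> \<in> {\<omega> \<in> space M. \<bar>B n \<omega>\<bar> > L} \<union> {\<omega> \<in> space M. \<bar>A n \<omega> - B n \<omega>\<bar> > \<rho>}"
        using \<omega> by (auto simp: not_le[symmetric])
    qed
    then have "prob {\<omega> \<in> space M. \<bar>sqrt (real n) * (F (q + A n \<omega> / sqrt (real n)) - F q) - c * B n \<omega>\<bar> > \<delta>}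
      \<le> prob ({\<omega> \<in> space M. \<bar>B n \<omega>\<bar> > L} \<union> {\<omega> \<in> space M. \<bar>A n \<omega> - B n \<omega>\<bar> > \<rho>})"
      by (intro finite_measure_mono) auto
    also have "\<dots> \<le> prob {\<omega> \<in> space M. \<bar>B n \<omega>\<bar> > L} + prob {\<omega> \<in> space M. \<bar>A n \<omega> - B n \<omega>\<bar> > \<rho>}"
      by (intro measure_Un_le) auto
    also have "\<dots> < \<eta>" using L[of n] elim(1) by linarith
    finally show ?case by simp
  qed
qed

text \<open>Finitely many times are irrelevant for a limit, which disposes of the sample sizes for which the cutoff is infinite.\<close>

lemma small_oP_sqrtI:
  assumes R: "\<And>n. R n \<in> borel_measurable M" and T: "vanishes_in_prob M T"
    and eq: "\<forall>\<^sub>F n in sequentially. \<forall>\<omega>\<in>space M. R n \<omega> = ereal (T n \<omega> / sqrt (real n))"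
  shows "small_oP M R (\<lambda>n. real n powr (- 1 / 2))"
  unfolding small_oP_def
proof (intro conjI allI impI R)
  fix \<delta> :: real assume "\<delta> > 0"
  then have lim: "(\<lambda>n. measure M {\<omega> \<in> space M. \<bar>T n \<omega>\<bar> > \<delta>}) \<longlonglongrightarrow> 0"
    using T by (simp add: vanishes_in_prob_def)
  have ev: "\<forall>\<^sub>F n in sequentially. measure M {\<omega> \<in> space M. \<bar>R n \<omega>\<bar> > ereal (\<delta> * real n powr (- 1 / 2))}
      = measure M {\<omega> \<in> space M. \<bar>T n \<omega>\<bar> > \<delta>}"
    using eq eventually_gt_at_top[of 0]
  proof eventually_elim
    case (elim n)
    have "\<bar>R n \<omega>\<bar> > ereal (\<delta> * real n powr (- 1 / 2)) \<longleftrightarrow> \<bar>T n \<omega>\<bar> > \<delta>" if "\<omega> \<in> space M" for \<omega>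
    proof -
      have "real n powr (- 1 / 2) = 1 / sqrt (real n)"
        using elim(2) by (simp add: powr_minus powr_half_sqrt divide_simps)
      then show ?thesis using elim that by (simp add: field_simps)
    qed
    then show ?case by (intro arg_cong[where f="measure M"]) auto
  qed
  show "(\<lambda>n. measure M {\<omega> \<in> space M. \<bar>R n \<omega>\<bar> > ereal (\<delta> * real n powr (- 1 / 2))}) \<longlonglongrightarrow> 0"
    using lim by (simp only: tendsto_cong[OF ev])
qed

section \<open>Order statistics, quantiles and densities\<close>

text \<open>Indices of a list of length \<open>n\<close> start at 0, so the entries at most \<open>v\<close> of the sorted list fill an
  initial segment of indices, which contains \<open>k - 1\<close> iff it has at least \<open>k\<close> elements.\<close>

lemma order_stat_le_iff:
  assumes "1 \<le> k" "k \<le> n"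
  shows "order_stat k (map f [1..<Suc n]) \<le> v \<longleftrightarrow> real k \<le> (\<Sum>t = 1..n. indicator {..v} (f t))"
proof -
  define ys where "ys = sort (map f [1..<Suc n])"
  have len: "length ys = n" and sorted: "sorted ys" by (simp_all add: ys_def)
  have "(\<Sum>t = 1..n. indicator {..v} (f t) :: real) = real (length (filter (\<lambda>x. x \<le> v) (map f [1..<Suc n])))"
    by (induction n) (auto simp: indicator_def)
  also have "length (filter (\<lambda>x. x \<le> v) (map f [1..<Suc n])) = length (filter (\<lambda>x. x \<le> v) ys)"
    unfolding ys_def by (metis mset_filter mset_sort size_mset)
  also have "\<dots> = card {i. i < n \<and> ys ! i \<le> v}"
    by (simp add: length_filter_conv_card len)
  finally have cnt: "(\<Sum>t = 1..n. indicator {..v} (f t) :: real) = real (card {i. i < n \<and> ys ! i \<le> v})" .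
  have "ys ! (k - 1) \<le> v \<longleftrightarrow> k \<le> card {i. i < n \<and> ys ! i \<le> v}"
  proof
    assume le: "ys ! (k - 1) \<le> v"
    have "ys ! i \<le> v" if "i < k" for i
    proof -
      have "ys ! i \<le> ys ! (k - 1)"
        using that assms len by (intro sorted_nth_mono[OF sorted]) auto
      then show ?thesis using le by simp
    qed
    then have "{..<k} \<subseteq> {i. i < n \<and> ys ! i \<le> v}" using assms by auto
    from card_mono[OF _ this] show "k \<le> card {i. i < n \<and> ys ! i \<le> v}" by simp
  next
    assume le: "k \<le> card {i. i < n \<and> ys ! i \<le> v}"
    show "ys ! (k - 1) \<le> v"
    proof (rule ccontr)
      assume gt: "\<not> ys ! (k - 1) \<le> v"
      have "i < k - 1" if "i < n" "ys ! i \<le> v" for i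
        using sorted_nth_mono[OF sorted, of "k - 1" i] that gt len by force
      then have "{i. i < n \<and> ys ! i \<le> v} \<subseteq> {..<k - 1}" by auto
      from card_mono[OF _ this] show False using le assms by simp
    qed
  qed
  then show ?thesis unfolding order_stat_def cnt ys_def[symmetric] by simp
qed

lemma conf_rank_bounds:
  assumes "0 < \<alpha>" "\<alpha> < 1"
  shows "1 \<le> conf_rank \<alpha> n" "\<bar>real (conf_rank \<alpha> n) - real n * (1 - \<alpha>)\<bar> \<le> 2"
proof -
  let ?r = "(real n + 1) * (1 - \<alpha>)"
  have pos: "?r > 0" using assms by simp
  then have c: "\<lceil>?r\<rceil> > 0" by simp
  then show "1 \<le> conf_rank \<alpha> n" unfolding conf_rank_def by linarith
  have "real (conf_rank \<alpha> n) = real_of_int \<lceil>?r\<rceil>" using c by (simp add: conf_rank_def)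
  moreover have "?r \<le> real_of_int \<lceil>?r\<rceil>" "real_of_int \<lceil>?r\<rceil> < ?r + 1" by linarith+
  moreover have "?r = real n * (1 - \<alpha>) + (1 - \<alpha>)" by (simp add: algebra_simps)
  ultimately show "\<bar>real (conf_rank \<alpha> n) - real n * (1 - \<alpha>)\<bar> \<le> 2" using assms by linarith
qed

lemma eventually_conf_rank_le:
  assumes "0 < \<alpha>" "\<alpha> < 1"
  shows "\<forall>\<^sub>F n in sequentially. conf_rank \<alpha> n \<le> n"
proof -
  have "filterlim (\<lambda>n. real n * \<alpha>) at_top sequentially" using assms(1) by real_asymp
  then have "\<forall>\<^sub>F n in sequentially. 2 \<le> real n * \<alpha>" by (simp add: filterlim_at_top)
  then show ?thesis
  proof eventually_elim
    case (elim n)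
    have "real (conf_rank \<alpha> n) \<le> real n * (1 - \<alpha>) + 2"
      using conf_rank_bounds(2)[OF assms, of n] by linarith
    also have "\<dots> \<le> real n" using elim by (simp add: algebra_simps)
    finally show ?case by simp
  qed
qed

lemma cdf_quantile_eq:
  fixes \<mu> :: "real measure"
  assumes "real_distribution \<mu>" and cont: "continuous_on UNIV (cdf \<mu>)" and p: "0 < p" "p < 1"
  shows "cdf \<mu> (quantile (cdf \<mu>) p) = p"
proof -
  interpret real_distribution \<mu> by fact
  let ?S = "{v. cdf \<mu> v \<ge> p}"
  have "\<forall>\<^sub>F v in at_bot. cdf \<mu> v < p" by (rule order_tendstoD(2)[OF cdf_lim_at_bot p(1)])
  then obtain a where a: "cdf \<mu> a < p" by (auto simp: eventually_at_bot_linorder)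
  have "\<forall>\<^sub>F v in at_top. cdf \<mu> v > p" by (rule order_tendstoD(1)[OF cdf_lim_at_top_prob p(2)])
  then obtain b where b: "cdf \<mu> b > p" by (auto simp: eventually_at_top_linorder)
  have lb: "a \<le> v" if "v \<in> ?S" for v
    using a that cdf_nondecreasing[of v a] by (cases "a \<le> v") auto
  then have bdd: "bdd_below ?S" by (rule bdd_belowI)
  have ne: "?S \<noteq> {}" using b by (auto intro!: exI[of _ b])
  have "closed ?S" using cont by (intro closed_Collect_le continuous_on_const) auto
  then have "Inf ?S \<in> ?S" using ne bdd by (intro closed_contains_Inf)
  then have ge: "p \<le> cdf \<mu> (Inf ?S)" by simp
  have "\<forall>v\<in>{..<Inf ?S}. cdf \<mu> v \<le> p"
  proof
    fix v assume "v \<in> {..<Inf ?S}"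
    then have "v \<notin> ?S" using cInf_lower[OF _ bdd, of v] by auto
    then show "cdf \<mu> v \<le> p" by simp
  qed
  moreover have "((cdf \<mu>) \<longlongrightarrow> cdf \<mu> (Inf ?S)) (at_left (Inf ?S))"
    using cont by (simp add: continuous_on_def filterlim_at_split)
  ultimately have "cdf \<mu> (Inf ?S) \<le> p"
    by (intro tendsto_upperbound[of "cdf \<mu>" _ "at_left (Inf ?S)"]) (auto simp: eventually_at_filter)
  then show ?thesis using ge by (simp add: quantile_def)
qed

lemma cdf_density_on_imp_deriv:
  assumes dens: "cdf_density_on F f (q - e) (q + e)" and "e > 0" and cont: "isCont f q"
  shows "(F has_real_derivative f q) (at q)"
proof -
  have int: "set_integrable lborel {q - e..q + e} f"
    and FF: "\<And>a b. q - e \<le> a \<Longrightarrow> a \<le> b \<Longrightarrow> b \<le> q + e \<Longrightarrow> F b - F a = (LINT v:{a..b}|lborel. f v)"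
    using dens by (auto simp: cdf_density_on_def)
  have "(F has_derivative (*) (f q)) (at q)"
    unfolding has_derivative_at_alt
  proof (intro conjI allI impI)
    show "bounded_linear ((*) (f q))" by (rule bounded_linear_mult_right)
    fix \<epsilon> :: real assume "\<epsilon> > 0"
    with cont obtain d0 where d0: "d0 > 0" "\<And>v. \<bar>v - q\<bar> < d0 \<Longrightarrow> \<bar>f v - f q\<bar> < \<epsilon>"
      unfolding continuous_at_real_range by (auto simp: dist_real_def)
    define d where "d = min d0 e"
    have d: "d > 0" using d0 \<open>e > 0\<close> by (simp add: d_def)
    \<comment> \<open>Integrating the oscillation bound for \<open>f\<close> over a short interval.\<close>
    have slope: "\<bar>F b - F a - f q * (b - a)\<bar> \<le> \<epsilon> * (b - a)"
      if ab: "a \<le> b" "q - d < a" "b < q + d" for a b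
    proof -
      have sub: "{a..b} \<subseteq> {q - e..q + e}" using ab by (auto simp: d_def)
      have i1: "set_integrable lborel {a..b} f" by (rule set_integrable_subset[OF int]) (use sub in auto)
      have i2: "set_integrable lborel {a..b} (\<lambda>v. c)" for c :: real
        unfolding set_integrable_def by (rule integrable_real_indicator[THEN integrable_scaleR_left]) (use ab in auto)
      have cst: "(LINT v:{a..b}|lborel. c) = c * (b - a)" for c :: real
        using ab by (simp add: set_lebesgue_integral_def)
      have bds: "f q - \<epsilon> \<le> f v" "f v \<le> f q + \<epsilon>" if "v \<in> {a..b}" for v
      proof -
        have "\<bar>v - q\<bar> < d0" using that ab by (auto simp: d_def)
        then have "\<bar>f v - f q\<bar> < \<epsilon>" by (rule d0)
        then show "f q - \<epsilon> \<le> f v" "f v \<le> f q + \<epsilon>" by linarith+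
      qed
      have "(LINT v:{a..b}|lborel. f q - \<epsilon>) \<le> (LINT v:{a..b}|lborel. f v)"
        by (rule set_integral_mono[OF i2 i1]) (rule bds)
      moreover have "(LINT v:{a..b}|lborel. f v) \<le> (LINT v:{a..b}|lborel. f q + \<epsilon>)"
        by (rule set_integral_mono[OF i1 i2]) (rule bds)
      moreover have "F b - F a = (LINT v:{a..b}|lborel. f v)" using ab by (intro FF) (auto simp: d_def)
      ultimately show ?thesis unfolding cst by (simp add: algebra_simps abs_le_iff)
    qed
    have "norm (F y - F q - f q * (y - q)) \<le> \<epsilon> * norm (y - q)" if "norm (y - q) < d" for y
    proof (cases "q \<le> y")
      case True
      then show ?thesis using slope[of q y] that d by simp
    next
      case False
      then have "\<bar>F q - F y - f q * (q - y)\<bar> \<le> \<epsilon> * (q - y)" using slope[of y q] that d by simp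
      moreover have "\<bar>F y - F q - f q * (y - q)\<bar> = \<bar>F q - F y - f q * (q - y)\<bar>"
        by (subst abs_minus_commute) (simp add: algebra_simps)
      ultimately show ?thesis using False by simp
    qed
    then show "\<exists>d>0. \<forall>y. norm (y - q) < d \<longrightarrow> norm (F y - F q - f q * (y - q)) \<le> \<epsilon> * norm (y - q)"
      using d by blast
  qed
  then show ?thesis by (simp add: has_field_derivative_def)
qed

section \<open>Empirical distribution functions of dependent scores\<close>

text \<open>The scores enter only as a function \<open>H\<close> of the past innovations, so predictor and covariates are
  absorbed into \<open>H\<close>.\<close>

locale physical_dependence = prob_space M for M :: "'w measure" +
  fixes S :: "'e measure" and eps :: "int \<Rightarrow> 'w \<Rightarrow> 'e" and eps' :: "'w \<Rightarrow> 'e"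
    and H :: "(nat \<Rightarrow> 'e) \<Rightarrow> real" and V V_star :: "int \<Rightarrow> 'w \<Rightarrow> real"
  assumes iid: "iid M S eps" and copy: "indep_copy M S eps eps'"
    and H_meas [measurable]: "H \<in> borel_measurable (PiM UNIV (\<lambda>_. S))"
    and V_eq: "\<And>t \<omega>. \<omega> \<in> space M \<Longrightarrow> V t \<omega> = H (past eps t \<omega>)"
    and V_star_eq: "\<And>t \<omega>. \<omega> \<in> space M \<Longrightarrow> V_star t \<omega> = H (past (eps(0 := eps')) t \<omega>)"
    and summable_theta: "summable (theta M V V_star)"
begin

abbreviation F :: "real \<Rightarrow> real" where "F \<equiv> cdf (distr M borel (V 0))"

lemma eps_meas: "eps t \<in> measurable M S"
  using iid unfolding iid_def indep_vars_def by auto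

lemma past_meas:
  assumes "\<And>t. e t \<in> measurable M S"
  shows "past e t \<in> measurable M (PiM UNIV (\<lambda>_. S))"
  unfolding past_def by (intro measurable_PiM_single') (auto intro: measurable_space[OF assms] assms)

lemma V_meas [measurable]: "V t \<in> borel_measurable M"
  using measurable_compose[OF past_meas[OF eps_meas] H_meas]
  by (rule measurable_cong[THEN iffD1, rotated]) (simp add: V_eq)

lemma V_star_meas [measurable]: "V_star t \<in> borel_measurable M"
proof -
  have "(eps(0 := eps')) s \<in> measurable M S" for s
    using eps_meas copy by (simp add: indep_copy_def)
  then have "past (eps(0 := eps')) t \<in> measurable M (PiM UNIV (\<lambda>_. S))"
    by (rule past_meas)
  from measurable_compose[OF this H_meas] show ?thesis
    by (rule measurable_cong[THEN iffD1, rotated]) (simp add: V_star_eq)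
qed

lemma expectation_indicator_V: "expectation (\<lambda>\<omega>. indicator {..v} (V 0 \<omega>)) = F v"
proof -
  have "F v = (\<integral>x. indicator {..v} x \<partial>distr M borel (V 0))"
    by (simp add: cdf_def)
  also have "\<dots> = expectation (\<lambda>\<omega>. indicator {..v} (V 0 \<omega>))"
    by (rule integral_distr) auto
  finally show ?thesis by simp
qed

lemma norm_L2_le_theta:
  "norm_L2 M (\<lambda>\<omega>. indicator {..v} (V (int k) \<omega>) - indicator {..v} (V_star (int k) \<omega>)) \<le> theta M V V_star k"
  unfolding theta_def
proof (rule cSUP_upper)
  show "bdd_above (range (\<lambda>v. norm_L2 M (\<lambda>\<omega>. indicator {..v} (V (int k) \<omega>) - indicator {..v} (V_star (int k) \<omega>))))"
  proof (rule bdd_aboveI2)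
    fix v
    have "expectation (\<lambda>\<omega>. \<bar>indicator {..v} (V (int k) \<omega>) - indicator {..v} (V_star (int k) \<omega>)\<bar>\<^sup>2) \<le> expectation (\<lambda>\<omega>. 1 :: real)"
      by (intro integral_mono integrable_bounded[of _ 1]) (auto simp: indicator_def)
    then show "norm_L2 M (\<lambda>\<omega>. indicator {..v} (V (int k) \<omega>) - indicator {..v} (V_star (int k) \<omega>)) \<le> 1"
      by (simp add: norm_L2_def prob_space)
  qed
qed simp

lemma theta_nonneg: "0 \<le> theta M V V_star k"
  by (rule order.trans[OF _ norm_L2_le_theta]) (simp add: norm_L2_def)

lemma indicator_dependence_le:
  "expectation (\<lambda>\<omega>. (indicator {..v} (V (int k) \<omega>) - indicator {..v} (V_star (int k) \<omega>))\<^sup>2) \<le> (theta M V V_star k)\<^sup>2"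
  using power_mono[OF norm_L2_le_theta, of v k 2]
  by (simp add: norm_L2_def)

lemma variance_sum_scores_le:
  fixes h :: "real \<Rightarrow> real"
  assumes [measurable]: "h \<in> borel_measurable borel" and h: "\<And>x. \<bar>h x\<bar> \<le> K"
    and d: "\<And>k. 0 \<le> d k" "summable d"
    and w: "0 \<le> w" "4 * expectation (\<lambda>\<omega>. (h (V 0 \<omega>))\<^sup>2) \<le> w\<^sup>2"
    and dep: "\<And>k. expectation (\<lambda>\<omega>. (h (V (int k) \<omega>) - h (V_star (int k) \<omega>))\<^sup>2) \<le> (d k)\<^sup>2"
  shows "expectation (\<lambda>\<omega>. (\<Sum>t = 1..n. h (V (int t) \<omega>) - expectation (\<lambda>\<omega>. h (V 0 \<omega>)))\<^sup>2)
    \<le> real n * (\<Sum>k. min (d k) w)\<^sup>2 / 2"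
proof -
  have V0: "expectation (\<lambda>\<omega>. \<phi> (V t \<omega>)) = expectation (\<lambda>\<omega>. \<phi> (H (past eps t \<omega>)))" for \<phi> :: "real \<Rightarrow> real" and t
    by (intro Bochner_Integration.integral_cong) (simp_all add: V_eq)
  have w': "4 * expectation (\<lambda>\<omega>. (h (H (past eps 0 \<omega>)))\<^sup>2) \<le> w\<^sup>2"
    using w(2) V0[of "\<lambda>x. (h x)\<^sup>2" 0] by simp
  have dep': "expectation (\<lambda>\<omega>. (h (H (past eps (int k) \<omega>)) - h (H (past (eps(0 := eps')) (int k) \<omega>)))\<^sup>2) \<le> (d k)\<^sup>2" for k
  proof -
    have "expectation (\<lambda>\<omega>. (h (H (past eps (int k) \<omega>)) - h (H (past (eps(0 := eps')) (int k) \<omega>)))\<^sup>2)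
        = expectation (\<lambda>\<omega>. (h (V (int k) \<omega>) - h (V_star (int k) \<omega>))\<^sup>2)"
      by (intro Bochner_Integration.integral_cong) (simp_all add: V_eq V_star_eq)
    then show ?thesis using dep[of k] by simp
  qed
  have "(\<lambda>x. h (H x)) \<in> borel_measurable (PiM UNIV (\<lambda>_. S))" by measurable
  from variance_sum_past_le[OF iid copy this h d w(1) w' dep', of n]
  have "expectation (\<lambda>\<omega>. (\<Sum>t = 1..n. h (H (past eps (int t) \<omega>)) - expectation (\<lambda>\<omega>. h (H (past eps 0 \<omega>))))\<^sup>2)
    \<le> real n * (\<Sum>k. min (d k) w)\<^sup>2 / 2" .
  moreover have "expectation (\<lambda>\<omega>. (\<Sum>t = 1..n. h (V (int t) \<omega>) - c)\<^sup>2)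
      = expectation (\<lambda>\<omega>. (\<Sum>t = 1..n. h (H (past eps (int t) \<omega>)) - c)\<^sup>2)" for c
    by (intro Bochner_Integration.integral_cong) (simp_all add: V_eq)
  ultimately show ?thesis by (simp add: V0)
qed

text \<open>An indicator has second moment at most 1, so the truncation level 2 is admissible; dropping the
  truncation afterwards only enlarges the bound.\<close>

lemma empirical_cdf_L2:
  "expectation (\<lambda>\<omega>. (\<Sum>t = 1..n. indicator {..v} (V (int t) \<omega>) - F v)\<^sup>2)
    \<le> real n * (suminf (theta M V V_star))\<^sup>2 / 2"
proof -
  let ?\<theta> = "theta M V V_star"
  have E: "4 * expectation (\<lambda>\<omega>. (indicator {..v} (V 0 \<omega>))\<^sup>2) \<le> (2::real)\<^sup>2"
  proof -
    have "expectation (\<lambda>\<omega>. (indicator {..v} (V 0 \<omega>))\<^sup>2) \<le> expectation (\<lambda>\<omega>. 1 :: real)"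
      by (intro integral_mono integrable_bounded[of _ 1]) (auto simp: indicator_def)
    then show ?thesis by (simp add: prob_space)
  qed
  have "expectation (\<lambda>\<omega>. (\<Sum>t = 1..n. indicator {..v} (V (int t) \<omega>) - F v)\<^sup>2)
     \<le> real n * (\<Sum>k. min (?\<theta> k) 2)\<^sup>2 / 2"
  proof -
    have "\<bar>indicator {..v} x :: real\<bar> \<le> 1" for x :: real by simp
    from variance_sum_scores_le[OF _ this theta_nonneg summable_theta _ E indicator_dependence_le, of n]
    show ?thesis by (simp add: expectation_indicator_V)
  qed
  also have "\<dots> \<le> real n * (suminf ?\<theta>)\<^sup>2 / 2"
  proof -
    have sm: "summable (\<lambda>k. min (?\<theta> k) 2)"
      using theta_nonneg by (intro summable_comparison_test'[OF summable_theta]) auto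
    have "(\<Sum>k. min (?\<theta> k) 2) \<le> suminf ?\<theta>" by (intro suminf_le sm summable_theta) auto
    moreover have "0 \<le> (\<Sum>k. min (?\<theta> k) 2)" using theta_nonneg by (intro suminf_nonneg sm) auto
    ultimately show ?thesis by (intro divide_right_mono mult_left_mono power_mono) auto
  qed
  finally show ?thesis .
qed

text \<open>The square of a difference of two threshold indicators is the indicator of an interval, so its mean
  is \<open>\<bar>F u - F v\<bar>\<close>. This gives the second term of the minimum, while the first one bounds the dependence of
  both indicators.\<close>

lemma empirical_cdf_increment_L2:
  "expectation (\<lambda>\<omega>. (\<Sum>t = 1..n. indicator {..u} (V (int t) \<omega>) - indicator {..v} (V (int t) \<omega>) - (F u - F v))\<^sup>2)
    \<le> real n * (\<Sum>k. min (2 * theta M V V_star k) (2 * sqrt \<bar>F u - F v\<bar>))\<^sup>2 / 2"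
proof -
  let ?\<theta> = "theta M V V_star"
  define h :: "real \<Rightarrow> real" where "h x = indicator {..u} x - indicator {..v} x" for x
  have [measurable]: "h \<in> borel_measurable borel" unfolding h_def by measurable
  have h: "\<bar>h x\<bar> \<le> 1" for x by (simp add: h_def indicator_def)
  have int: "integrable M (\<lambda>\<omega>. indicator {..v} (V 0 \<omega>) :: real)" for v
    by (intro integrable_bounded[of _ 1]) auto
  have Eh: "expectation (\<lambda>\<omega>. h (V 0 \<omega>)) = F u - F v"
    unfolding h_def using int by (simp add: expectation_indicator_V)
  have E: "4 * expectation (\<lambda>\<omega>. (h (V 0 \<omega>))\<^sup>2) \<le> (2 * sqrt \<bar>F u - F v\<bar>)\<^sup>2"
  proof -
    have "expectation (\<lambda>\<omega>. (h (V 0 \<omega>))\<^sup>2) = \<bar>F u - F v\<bar>"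
    proof (cases "u \<le> v")
      case True
      then have "(h x)\<^sup>2 = - h x" for x by (auto simp: h_def indicator_def)
      then have "expectation (\<lambda>\<omega>. (h (V 0 \<omega>))\<^sup>2) = F v - F u" using Eh by simp
      moreover have "0 \<le> expectation (\<lambda>\<omega>. (h (V 0 \<omega>))\<^sup>2)" by simp
      ultimately show ?thesis by linarith
    next
      case False
      then have "(h x)\<^sup>2 = h x" for x by (auto simp: h_def indicator_def)
      then have "expectation (\<lambda>\<omega>. (h (V 0 \<omega>))\<^sup>2) = F u - F v" using Eh by simp
      moreover have "0 \<le> expectation (\<lambda>\<omega>. (h (V 0 \<omega>))\<^sup>2)" by simp
      ultimately show ?thesis by linarith
    qed
    then show ?thesis by (simp add: power_mult_distrib)
  qed
  have dep: "expectation (\<lambda>\<omega>. (h (V (int k) \<omega>) - h (V_star (int k) \<omega>))\<^sup>2) \<le> (2 * ?\<theta> k)\<^sup>2" for k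
  proof -
    let ?D = "\<lambda>v \<omega>. indicator {..v} (V (int k) \<omega>) - indicator {..v} (V_star (int k) \<omega>) :: real"
    have intD: "integrable M (\<lambda>\<omega>. (?D v \<omega>)\<^sup>2)" for v
      by (intro integrable_bounded[of _ 1]) (auto simp: indicator_def)
    have "expectation (\<lambda>\<omega>. (h (V (int k) \<omega>) - h (V_star (int k) \<omega>))\<^sup>2)
        \<le> expectation (\<lambda>\<omega>. 2 * (?D u \<omega>)\<^sup>2 + 2 * (?D v \<omega>)\<^sup>2)"
    proof (rule integral_mono)
      show "integrable M (\<lambda>\<omega>. (h (V (int k) \<omega>) - h (V_star (int k) \<omega>))\<^sup>2)"
        by (intro integrable_bounded[of _ 4]) (auto simp: h_def indicator_def)
      show "(h (V (int k) \<omega>) - h (V_star (int k) \<omega>))\<^sup>2 \<le> 2 * (?D u \<omega>)\<^sup>2 + 2 * (?D v \<omega>)\<^sup>2" for \<omega>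
        by (simp add: h_def indicator_def)
    qed (use intD in auto)
    also have "\<dots> = 2 * expectation (\<lambda>\<omega>. (?D u \<omega>)\<^sup>2) + 2 * expectation (\<lambda>\<omega>. (?D v \<omega>)\<^sup>2)"
      using intD by simp
    also have "\<dots> \<le> 2 * (?\<theta> k)\<^sup>2 + 2 * (?\<theta> k)\<^sup>2"
      using indicator_dependence_le[of u k] indicator_dependence_le[of v k] by linarith
    finally show ?thesis by (simp add: power_mult_distrib)
  qed
  have "expectation (\<lambda>\<omega>. (\<Sum>t = 1..n. h (V (int t) \<omega>) - expectation (\<lambda>\<omega>. h (V 0 \<omega>)))\<^sup>2)
    \<le> real n * (\<Sum>k. min (2 * ?\<theta> k) (2 * sqrt \<bar>F u - F v\<bar>))\<^sup>2 / 2"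
    by (rule variance_sum_scores_le[OF _ h _ _ _ E dep]) (use theta_nonneg summable_theta in auto)
  then show ?thesis unfolding Eh by (simp add: h_def)
qed

text \<open>Each term is killed by the truncation level and the series is dominated by \<open>2 \<Theta>\<close>, so Tannery's theorem
  applies. With \<open>empirical_cdf_increment_L2\<close> this is the stochastic equicontinuity of the empirical process.\<close>

lemma truncated_theta_sum_tendsto_0:
  assumes w: "w \<longlonglongrightarrow> 0" "\<And>n. 0 \<le> w n"
  shows "(\<lambda>n. \<Sum>k. min (2 * theta M V V_star k) (w n)) \<longlonglongrightarrow> 0"
proof -
  have "(\<lambda>n. \<Sum>k. min (2 * theta M V V_star k) (w n)) \<longlonglongrightarrow> (\<Sum>k. min (2 * theta M V V_star k) 0)"
  proof (rule tannerys_theorem[THEN conjunct2, THEN conjunct2])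
    show "(\<lambda>n. min (2 * theta M V V_star k) (w n)) \<longlonglongrightarrow> min (2 * theta M V V_star k) 0" for k
      by (intro tendsto_min tendsto_const w)
    show "\<forall>\<^sub>F (k, n) in at_top \<times>\<^sub>F sequentially. norm (min (2 * theta M V V_star k) (w n)) \<le> 2 * theta M V V_star k"
      using theta_nonneg w(2) by (intro always_eventually) auto
    show "summable (\<lambda>k. 2 * theta M V V_star k)" using summable_theta by simp
  qed simp
  then show ?thesis using theta_nonneg by simp
qed

end

section \<open>The representation of the cutoff\<close>

lemma (in prob_space) integrable_square_sum:
  fixes g :: "nat \<Rightarrow> 'a \<Rightarrow> real"
  assumes [measurable]: "\<And>t. g t \<in> borel_measurable M" and g: "\<And>t \<omega>. \<bar>g t \<omega>\<bar> \<le> K"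
  shows "integrable M (\<lambda>\<omega>. (\<Sum>t = 1..n. g t \<omega>)\<^sup>2)"
proof (rule integrable_bounded)
  fix \<omega>
  have "\<bar>\<Sum>t = 1..n. g t \<omega>\<bar> \<le> (\<Sum>t = 1..n. K)"
    by (rule order.trans[OF sum_abs]) (intro sum_mono g)
  then have "\<bar>\<Sum>t = 1..n. g t \<omega>\<bar>\<^sup>2 \<le> (real n * K)\<^sup>2"
    by (intro power_mono) auto
  then show "\<bar>(\<Sum>t = 1..n. g t \<omega>)\<^sup>2\<bar> \<le> (real n * K)\<^sup>2" by simp
qed measurable

lemma sqrt_n_increment_tendsto:
  fixes F :: "real \<Rightarrow> real"
  assumes "(F has_real_derivative c) (at q)"
  shows "(\<lambda>n. sqrt (real n) * (F (q + y / sqrt (real n)) - F q)) \<longlonglongrightarrow> y * c"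
proof (cases "y = 0")
  case False
  have lim: "filterlim (\<lambda>n. y / sqrt (real n)) (at 0) sequentially"
    unfolding filterlim_at
  proof
    show "\<forall>\<^sub>F n in sequentially. y / sqrt (real n) \<in> UNIV \<and> y / sqrt (real n) \<noteq> 0"
      using eventually_gt_at_top[of 0] by eventually_elim (use False in auto)
    show "(\<lambda>n. y / sqrt (real n)) \<longlonglongrightarrow> 0" by real_asymp
  qed
  have "((\<lambda>h. (F (q + h) - F q) / h) \<longlongrightarrow> c) (at 0)"
    using assms by (simp add: DERIV_def)
  from tendsto_mult_left[OF filterlim_compose[OF this lim], of y]
  have "(\<lambda>n. y * ((F (q + y / sqrt (real n)) - F q) / (y / sqrt (real n)))) \<longlonglongrightarrow> y * c" .
  then show ?thesis using False by (simp add: mult.commute)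
qed simp

context physical_dependence
begin

text \<open>In the rescaled variables \<open>A = sqrt n (q_n - q)\<close> and \<open>B\<close>, the linear term of the second expansion times
  \<open>sqrt n\<close>, the second claim reads \<open>A - B \<rightarrow> 0\<close> in probability, and the first one follows from it by linearizing \<open>F\<close>
  at \<open>q\<close>.\<close>

theorem conformal_cutoff_representation:
  assumes \<alpha>: "0 < \<alpha>" "\<alpha> < 1" and q: "q = quantile F (1 - \<alpha>)"
    and cont: "continuous_on UNIV F" and deriv: "(F has_real_derivative c) (at q)" and c: "0 < c"
  shows "small_oP M
           (\<lambda>n \<omega>. ereal (cdf_ereal (distr M borel (V 0)) (conf_cutoff V \<alpha> n \<omega>) - (1 - \<alpha>)
              - (- (1 / real n) * (\<Sum>t = 1..n. indicator {..q} (V (int t) \<omega>) - (1 - \<alpha>)))))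
           (\<lambda>n. real n powr (- 1 / 2))" (is "small_oP M ?R1 _")
    and "small_oP M
           (\<lambda>n \<omega>. conf_cutoff V \<alpha> n \<omega> - ereal q
              - ereal (- (1 / (real n * c)) * (\<Sum>t = 1..n. indicator {..q} (V (int t) \<omega>) - (1 - \<alpha>))))
           (\<lambda>n. real n powr (- 1 / 2))" (is "small_oP M ?R2 _")
proof -
  define p where "p = 1 - \<alpha>"
  have Fq: "F q = p"
    unfolding q p_def using \<alpha>
    by (intro cdf_quantile_eq cont real_distribution_distr) auto
  have [measurable]: "F \<in> borel_measurable borel" by (rule borel_measurable_continuous_onI[OF cont])
  define k where "k n = conf_rank \<alpha> n" for n
  have k1: "1 \<le> k n" and kp: "\<bar>real (k n) - real n * p\<bar> \<le> 2" for n
    using conf_rank_bounds[OF \<alpha>, of n] by (simp_all add: k_def p_def)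
  have ev_k: "\<forall>\<^sub>F n in sequentially. k n \<le> n"
    using eventually_conf_rank_le[OF \<alpha>] by (simp add: k_def)
  \<comment> \<open>A real-valued version of the cutoff; the default \<open>q\<close> concerns finitely many \<open>n\<close> only and keeps it measurable.\<close>
  define r where "r n \<omega> = (if k n \<le> n then order_stat (k n) (map (\<lambda>t. V (int t) \<omega>) [1..<Suc n]) else q)" for n \<omega>
  have cutoff: "conf_cutoff V \<alpha> n \<omega> = (if k n \<le> n then ereal (r n \<omega>) else \<infinity>)" for n \<omega>
    by (simp add: conf_cutoff_def r_def k_def)
  have r_le: "r n \<omega> \<le> v \<longleftrightarrow> real (k n) \<le> (\<Sum>t = 1..n. indicator {..v} (V (int t) \<omega>))" if "k n \<le> n" for n \<omega> v
    using order_stat_le_iff[OF k1 that, of "\<lambda>t. V (int t) \<omega>" v] that by (simp add: r_def)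
  have r_meas [measurable]: "r n \<in> borel_measurable M" for n
  proof (cases "k n \<le> n")
    case True
    show ?thesis
      unfolding borel_measurable_iff_le
    proof
      fix a
      have "{w \<in> space M. r n w \<le> a} = {w \<in> space M. real (k n) \<le> (\<Sum>t = 1..n. indicator {..a} (V (int t) w))}"
        using r_le[OF True] by auto
      also have "\<dots> \<in> events" by measurable
      finally show "{w \<in> space M. r n w \<le> a} \<in> events" .
    qed
  next
    case False
    then have "r n = (\<lambda>_. q)" by (simp add: r_def[abs_def])
    then show ?thesis by simp
  qed
  define scale where "scale n = - (1 / (sqrt (real n) * c))" for n
  have scale_sq: "(scale n)\<^sup>2 * (real n * X / 2) \<le> X / (2 * c\<^sup>2)" if "0 \<le> X" for n X
    using that c by (cases "n = 0") (auto simp: scale_def field_simps power_mult_distrib)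
  define Z where "Z u n \<omega> = scale n * (\<Sum>t = 1..n. indicator {..u} (V (int t) \<omega>) - F u)" for u n \<omega>
  have Z_meas [measurable]: "Z u n \<in> borel_measurable M" for u n
    unfolding Z_def by measurable
  have F01: "0 \<le> F u" "F u \<le> 1" for u
    using prob_space.prob_le_1[OF prob_space_distr[OF V_meas[of 0]]] by (simp_all add: cdf_def)
  define A where "A n \<omega> = sqrt (real n) * (r n \<omega> - q)" for n \<omega>
  define B where "B = Z q"
  have A_meas [measurable]: "A n \<in> borel_measurable M" for n unfolding A_def by measurable
  have B_meas [measurable]: "B n \<in> borel_measurable M" for n unfolding B_def by measurable
  have B_bdd: "bounded_in_prob M B"
  proof (rule bounded_in_probI_L2[OF B_meas])
    fix n
    let ?S = "\<lambda>\<omega>. \<Sum>t = 1..n. indicator {..q} (V (int t) \<omega>) - F q"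
    have "\<bar>indicator {..q} x - F q\<bar> \<le> 1" for x using F01[of q] by (auto simp: indicator_def)
    then have int: "integrable M (\<lambda>\<omega>. (?S \<omega>)\<^sup>2)" by (intro integrable_square_sum) auto
    show "integrable M (\<lambda>\<omega>. (B n \<omega>)\<^sup>2)"
      using int by (simp add: B_def Z_def power_mult_distrib)
    have "expectation (\<lambda>\<omega>. (B n \<omega>)\<^sup>2) = (scale n)\<^sup>2 * expectation (\<lambda>\<omega>. (?S \<omega>)\<^sup>2)"
      by (simp add: B_def Z_def power_mult_distrib)
    also have "\<dots> \<le> (scale n)\<^sup>2 * (real n * (suminf (theta M V V_star))\<^sup>2 / 2)"
      by (intro mult_left_mono empirical_cdf_L2) auto
    also have "\<dots> \<le> (suminf (theta M V V_star))\<^sup>2 / (2 * c\<^sup>2)"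
      by (rule scale_sq) simp
    finally show "expectation (\<lambda>\<omega>. (B n \<omega>)\<^sup>2) \<le> (suminf (theta M V V_star))\<^sup>2 / (2 * c\<^sup>2)" .
  qed
  have AB: "vanishes_in_prob M (\<lambda>n \<omega>. A n \<omega> - B n \<omega>)"
  proof (rule ghosh_comparison[OF A_meas B_meas B_bdd])
    fix y :: real
    \<comment> \<open>\<open>A \<le> y\<close> means that at least \<open>k n\<close> scores lie below \<open>u n\<close>. Centring and rescaling this count gives the
        event \<open>Z (u n) n \<le> level n\<close>, in which the level tends to \<open>y\<close> because \<open>F\<close> has slope \<open>c\<close> at \<open>q\<close> and
        rounding moves the rank by at most 2.\<close>
    define u where "u n = q + y / sqrt (real n)" for n
    define level where "level n = sqrt (real n) / c * (F (u n) - real (k n) / real n)" for n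
    have level_lim: "level \<longlonglongrightarrow> y"
    proof -
      have rank: "(\<lambda>n. sqrt (real n) * (p - real (k n) / real n)) \<longlonglongrightarrow> 0"
      proof (rule tendsto_rabs_zero_cancel, rule tendsto_sandwich)
        show "\<forall>\<^sub>F n in sequentially. 0 \<le> \<bar>sqrt (real n) * (p - real (k n) / real n)\<bar>" by simp
        show "\<forall>\<^sub>F n in sequentially. \<bar>sqrt (real n) * (p - real (k n) / real n)\<bar> \<le> 2 / sqrt (real n)"
          using eventually_gt_at_top[of 0]
        proof eventually_elim
          case (elim n)
          have "sqrt (real n) * (p - real (k n) / real n) = (real n * p - real (k n)) / sqrt (real n)"
            using elim by (simp add: field_simps flip: real_sqrt_mult)
          also have "\<bar>\<dots>\<bar> = \<bar>real (k n) - real n * p\<bar> / sqrt (real n)" by (simp add: abs_minus_commute)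
          also have "\<dots> \<le> 2 / sqrt (real n)" using kp by (intro divide_right_mono) auto
          finally show ?case .
        qed
        show "(\<lambda>n. 2 / sqrt (real n)) \<longlonglongrightarrow> 0" by real_asymp
      qed simp
      have "(\<lambda>n. (sqrt (real n) * (F (u n) - F q) + sqrt (real n) * (p - real (k n) / real n)) / c) \<longlonglongrightarrow> (y * c + 0) / c"
        using c unfolding u_def
        by (intro tendsto_divide tendsto_add sqrt_n_increment_tendsto[OF deriv] rank) auto
      then show ?thesis using c by (simp add: level_def[abs_def] Fq algebra_simps diff_divide_distrib add_divide_distrib)
    qed
    have iff: "\<forall>\<^sub>F n in sequentially. \<forall>\<omega>\<in>space M. A n \<omega> \<le> y \<longleftrightarrow> Z (u n) n \<omega> \<le> level n"
      using ev_k eventually_gt_at_top[of 0]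
    proof eventually_elim
      case (elim n)
      show ?case
      proof
        fix \<omega>
        let ?N = "\<Sum>t = 1..n. indicator {..u n} (V (int t) \<omega>) :: real"
        have n: "sqrt (real n) > 0" "real n > 0" using elim by auto
        have "A n \<omega> \<le> y \<longleftrightarrow> r n \<omega> \<le> u n"
          using n by (simp add: A_def u_def field_simps)
        also have "\<dots> \<longleftrightarrow> real n * F (u n) - ?N \<le> real n * F (u n) - real (k n)"
          using r_le[OF elim(1)] by simp
        also have "\<dots> \<longleftrightarrow> (real n * F (u n) - ?N) / (sqrt (real n) * c) \<le> (real n * F (u n) - real (k n)) / (sqrt (real n) * c)"
        proof -
          have "(a / b \<le> d / b) = (a \<le> d)" if "0 < b" for a b d :: real
            using that by (simp add: divide_le_cancel)
          from this[of "sqrt (real n) * c"] show ?thesis using n c by (metis mult_pos_pos)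
        qed
        also have "(real n * F (u n) - ?N) / (sqrt (real n) * c) = Z (u n) n \<omega>"
          by (simp add: Z_def scale_def sum_subtractf diff_divide_distrib)
        also have "(real n * F (u n) - real (k n)) / (sqrt (real n) * c) = level n"
        proof -
          have "(real n * F (u n) - real (k n)) / (sqrt (real n) * c)
              = (real n / sqrt (real n)) / c * (F (u n) - real (k n) / real n)"
            using n c by (simp add: field_simps)
          then show ?thesis by (simp add: level_def real_div_sqrt)
        qed
        finally show "A n \<omega> \<le> y \<longleftrightarrow> Z (u n) n \<omega> \<le> level n" .
      qed
    qed
    define W where "W n = (\<Sum>k. min (2 * theta M V V_star k) (2 * sqrt \<bar>F (u n) - F q\<bar>))" for n
    have u_lim: "(\<lambda>n. F (u n)) \<longlonglongrightarrow> F q"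
    proof -
      have "u \<longlonglongrightarrow> q" unfolding u_def by real_asymp
      moreover have "isCont F q" using deriv by (rule DERIV_isCont)
      ultimately show ?thesis by (rule isCont_tendsto_compose[rotated])
    qed
    have "(\<lambda>n. 2 * sqrt \<bar>F (u n) - F q\<bar>) \<longlonglongrightarrow> 2 * sqrt \<bar>F q - F q\<bar>"
      by (intro tendsto_intros u_lim)
    then have W_lim: "W \<longlonglongrightarrow> 0"
      unfolding W_def by (intro truncated_theta_sum_tendsto_0) auto
    have van: "vanishes_in_prob M (\<lambda>n \<omega>. Z (u n) n \<omega> - B n \<omega>)"
    proof (rule vanishes_in_probI_L2[where s = "\<lambda>n. (W n)\<^sup>2 / (2 * c\<^sup>2)"])
      let ?S = "\<lambda>n \<omega>. \<Sum>t = 1..n. indicator {..u n} (V (int t) \<omega>) - indicator {..q} (V (int t) \<omega>) - (F (u n) - F q)"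
      have diff: "Z (u n) n \<omega> - B n \<omega> = scale n * ?S n \<omega>" for n \<omega>
        unfolding Z_def B_def right_diff_distrib[symmetric] sum_subtractf[symmetric]
        by (intro arg_cong2[where f="(*)"] sum.cong) simp_all
      have "\<bar>indicator {..u n} x - indicator {..q} x - (F (u n) - F q)\<bar> \<le> 2" for n x
        using F01[of q] F01[of "u n"] by (auto simp: indicator_def)
      then have int: "integrable M (\<lambda>\<omega>. (?S n \<omega>)\<^sup>2)" for n by (intro integrable_square_sum) auto
      show "integrable M (\<lambda>\<omega>. (Z (u n) n \<omega> - B n \<omega>)\<^sup>2)" for n
        unfolding diff power_mult_distrib using int by simp
      show "\<forall>\<^sub>F n in sequentially. expectation (\<lambda>\<omega>. (Z (u n) n \<omega> - B n \<omega>)\<^sup>2) \<le> (W n)\<^sup>2 / (2 * c\<^sup>2)"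
      proof (intro always_eventually allI)
        fix n
        have "expectation (\<lambda>\<omega>. (Z (u n) n \<omega> - B n \<omega>)\<^sup>2) = (scale n)\<^sup>2 * expectation (\<lambda>\<omega>. (?S n \<omega>)\<^sup>2)"
          unfolding diff power_mult_distrib by simp
        also have "\<dots> \<le> (scale n)\<^sup>2 * (real n * (W n)\<^sup>2 / 2)"
          unfolding W_def by (intro mult_left_mono empirical_cdf_increment_L2) auto
        also have "\<dots> \<le> (W n)\<^sup>2 / (2 * c\<^sup>2)" by (rule scale_sq) simp
        finally show "expectation (\<lambda>\<omega>. (Z (u n) n \<omega> - B n \<omega>)\<^sup>2) \<le> (W n)\<^sup>2 / (2 * c\<^sup>2)" .
      qed
      have "(\<lambda>n. (W n)\<^sup>2 / (2 * c\<^sup>2)) \<longlonglongrightarrow> 0\<^sup>2 / (2 * c\<^sup>2)"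
        using c by (intro tendsto_intros W_lim) auto
      then show "(\<lambda>n. (W n)\<^sup>2 / (2 * c\<^sup>2)) \<longlonglongrightarrow> 0" by simp
    qed measurable
    show "\<exists>Z c. (\<forall>n. Z n \<in> borel_measurable M) \<and> c \<longlonglongrightarrow> y \<and>
      (\<forall>\<^sub>F n in sequentially. \<forall>\<omega>\<in>space M. A n \<omega> \<le> y \<longleftrightarrow> Z n \<omega> \<le> c n) \<and>
      vanishes_in_prob M (\<lambda>n \<omega>. Z n \<omega> - B n \<omega>)"
      using level_lim iff van by (intro exI[of _ "\<lambda>n. Z (u n) n"] exI[of _ level]) auto
  qed
  let ?S = "\<lambda>n \<omega>. \<Sum>t = 1..n. indicator {..q} (V (int t) \<omega>) - (1 - \<alpha>) :: real"
  have B_S: "B n \<omega> = scale n * ?S n \<omega>" for n \<omega> by (simp add: B_def Z_def Fq p_def)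
  show "small_oP M ?R1 (\<lambda>n. real n powr (- 1 / 2))"
  proof (rule small_oP_sqrtI[OF _ linearize_in_prob[OF A_meas B_meas B_bdd AB deriv]])
    show "?R1 n \<in> borel_measurable M" for n
      by (cases "k n \<le> n") (simp_all add: cutoff)
    show "\<forall>\<^sub>F n in sequentially. \<forall>\<omega>\<in>space M. ?R1 n \<omega>
       = ereal ((sqrt (real n) * (F (q + A n \<omega> / sqrt (real n)) - F q) - c * B n \<omega>) / sqrt (real n))"
      using ev_k eventually_gt_at_top[of 0]
    proof eventually_elim
      case (elim n)
      show ?case
      proof
        fix \<omega>
        have n: "sqrt (real n) > 0" using elim by auto
        have "q + A n \<omega> / sqrt (real n) = r n \<omega>" using n by (simp add: A_def)
        moreover have "c * B n \<omega> / sqrt (real n) = - (1 / real n) * ?S n \<omega>"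
          using n c by (simp add: B_S scale_def)
        ultimately show "?R1 n \<omega>
           = ereal ((sqrt (real n) * (F (q + A n \<omega> / sqrt (real n)) - F q) - c * B n \<omega>) / sqrt (real n))"
          using n elim(1) by (simp add: cutoff Fq p_def diff_divide_distrib)
      qed
    qed
  qed
  show "small_oP M ?R2 (\<lambda>n. real n powr (- 1 / 2))"
  proof (rule small_oP_sqrtI[OF _ AB])
    show "?R2 n \<in> borel_measurable M" for n
      by (cases "k n \<le> n") (simp_all add: cutoff)
    show "\<forall>\<^sub>F n in sequentially. \<forall>\<omega>\<in>space M. ?R2 n \<omega> = ereal ((A n \<omega> - B n \<omega>) / sqrt (real n))"
      using ev_k eventually_gt_at_top[of 0]
    proof eventually_elim
      case (elim n)
      show ?case
      proof
        fix \<omega>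
        have n: "sqrt (real n) > 0" using elim by auto
        have "A n \<omega> / sqrt (real n) = r n \<omega> - q" using n by (simp add: A_def)
        moreover have "B n \<omega> / sqrt (real n) = - (1 / (real n * c)) * ?S n \<omega>"
          using n c by (simp add: B_S scale_def)
        ultimately show "?R2 n \<omega> = ereal ((A n \<omega> - B n \<omega>) / sqrt (real n))"
          using elim(1) by (simp add: cutoff diff_divide_distrib)
      qed
    qed
  qed
qed

end

theorem theorem2:
  fixes M :: "'w measure"
    and S :: "'e measure"
    and eps :: "int \<Rightarrow> 'w \<Rightarrow> 'e"
    and eps' :: "'w \<Rightarrow> 'e"
    and G :: "(nat \<Rightarrow> 'e) \<Rightarrow> (real ^ 'd) \<times> real"
    and muhat :: "real ^ 'd \<Rightarrow> real"
    and X :: "int \<Rightarrow> 'w \<Rightarrow> real ^ 'd"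
    and Y :: "int \<Rightarrow> 'w \<Rightarrow> real"
    and V V_star :: "int \<Rightarrow> 'w \<Rightarrow> real"
    and F f :: "real \<Rightarrow> real"
    and \<alpha> q e c_f C_f :: real
    and qhat :: "nat \<Rightarrow> 'w \<Rightarrow> ereal"
  assumes "prob_space M"
    and "iid M S eps"
    and "indep_copy M S eps eps'"
    and "G \<in> borel_measurable (PiM UNIV (\<lambda>_. S))"
    and "muhat \<in> borel_measurable borel"
    and "\<And>t \<omega>. \<omega> \<in> space M \<Longrightarrow> (X t \<omega>, Y t \<omega>) = G (past eps t \<omega>)"
    and "V = (\<lambda>t \<omega>. \<bar>Y t \<omega> - muhat (X t \<omega>)\<bar>)"
    and "V_star = (\<lambda>t \<omega>. score_fun G muhat (past (eps(0 := eps')) t \<omega>))"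
    and "F = cdf (distr M borel (V 0))"
    and "0 < \<alpha>" and "\<alpha> < 1"
    and "q = quantile F (1 - \<alpha>)"
    and "qhat = conf_cutoff V \<alpha>"
    and "continuous_on UNIV F"
    and "summable (theta M V V_star)"
    and "0 < e" and "0 < c_f" and "c_f \<le> C_f"
    and "cdf_density_on F f (q - e) (q + e)"
    and "\<And>v. \<bar>v - q\<bar> \<le> e \<Longrightarrow> c_f \<le> f v \<and> f v \<le> C_f"
    and "isCont f q"
    and "\<And>s t. s \<noteq> t \<Longrightarrow> measure M {\<omega> \<in> space M. V s \<omega> = V t \<omega>} = 0"
  shows "small_oP M
           (\<lambda>n \<omega>. ereal (cdf_ereal (distr M borel (V 0)) (qhat n \<omega>) - (1 - \<alpha>)
              - (- (1 / real n) * (\<Sum>t = 1..n. indicator {..q} (V (int t) \<omega>) - (1 - \<alpha>)))))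
           (\<lambda>n. real n powr (- 1 / 2))
       \<and> small_oP M
           (\<lambda>n \<omega>. qhat n \<omega> - ereal q
              - ereal (- (1 / (real n * f q)) * (\<Sum>t = 1..n. indicator {..q} (V (int t) \<omega>) - (1 - \<alpha>))))
           (\<lambda>n. real n powr (- 1 / 2))"
proof -
  interpret prob_space M by fact
  have [measurable]: "G \<in> borel_measurable (PiM UNIV (\<lambda>_. S))" "muhat \<in> borel_measurable borel" by fact+
  have [measurable]: "(fst :: (real ^ 'd) \<times> real \<Rightarrow> _) \<in> borel_measurable borel"
    "(snd :: (real ^ 'd) \<times> real \<Rightarrow> _) \<in> borel_measurable borel"
    by (intro borel_measurable_continuous_onI continuous_intros)+
  have H: "score_fun G muhat \<in> borel_measurable (PiM UNIV (\<lambda>_. S))"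
    unfolding score_fun_def by measurable
  have XY: "X t \<omega> = fst (G (past eps t \<omega>))" "Y t \<omega> = snd (G (past eps t \<omega>))" if "\<omega> \<in> space M" for t \<omega>
    using assms(6)[OF that, of t] by (metis fst_conv, metis snd_conv)
  interpret physical_dependence M S eps eps' "score_fun G muhat" V V_star
  proof
    show "V t \<omega> = score_fun G muhat (past eps t \<omega>)" if "\<omega> \<in> space M" for t \<omega>
      unfolding \<open>V = _\<close> score_fun_def using XY[OF that] by simp
    show "V_star t \<omega> = score_fun G muhat (past (eps(0 := eps')) t \<omega>)" if "\<omega> \<in> space M" for t \<omega>
      unfolding \<open>V_star = _\<close> by simp
  qed (fact assms H)+
  have deriv: "(F has_real_derivative f q) (at q)"
    by (rule cdf_density_on_imp_deriv) fact+
  have "f q > 0"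
    using \<open>0 < c_f\<close> assms(20)[of q] \<open>0 < e\<close> by simp
  from conformal_cutoff_representation[OF \<open>0 < \<alpha>\<close> \<open>\<alpha> < 1\<close> _ _ _ this, of q] deriv
  show ?thesis
    using \<open>q = _\<close> \<open>continuous_on UNIV F\<close> unfolding \<open>qhat = _\<close> \<open>F = _\<close> by blast
qed

end
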